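(* Let $G$ be a $d$-regular graph on $n$ vertices, and let $H=H(G)$ be the irregular random subgraph of $G$. Then for every integer $0\le k\le d$, the random variable $X = m(H,k)$ satisfies $\operatorname{Var}(X) \le 17\,\frac{n}{d+1}$.
   Context: The irregular random subgraph $H=H(G)$ of a graph $G$ is the random spanning subgraph obtained as follows: independently for each vertex $v\in V(G)$ choose $x(v)\in[0,1]$ uniformly at random, and let an edge $uv$ of $G$ be an edge of $H$ if and only if $x(u)+x(v)\ge 1$. For a graph $H$ and integer $k\ge 0$, $m(H,k)$ denotes the number of vertices of $H$ of degree exactly $k$. *)

theory Defs
  imports "HOL-Probability.Probability" "Graph_Theory.Pair_Digraph"
begin

text \<open>
  Finite simple graphs are the graphs of the locale \<^locale>\<open>pair_graph\<close>: finite, loop-free and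
  symmetric, so every undirected edge $uv$ is represented by the two arcs $(u,v)$ and $(v,u)$.
  The degree of a vertex is therefore its out-degree, the number of its neighbours.
\<close>

definition vertex_degree :: "'a pair_pre_digraph \<Rightarrow> 'a \<Rightarrow> nat" where
  "vertex_degree G v = out_degree (with_proj G) v"

definition regular :: "'a pair_pre_digraph \<Rightarrow> nat \<Rightarrow> bool" where
  "regular G d \<longleftrightarrow> (\<forall>v \<in> pverts G. vertex_degree G v = d)"

definition num_degree :: "'a pair_pre_digraph \<Rightarrow> nat \<Rightarrow> nat" where
  "num_degree H k = card {v \<in> pverts H. vertex_degree H v = k}"

definition weight_space :: "'a pair_pre_digraph \<Rightarrow> ('a \<Rightarrow> real) measure" where
  "weight_space G = PiM (pverts G) (\<lambda>_. uniform_measure lborel {0..1})"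

definition irregular_subgraph :: "'a pair_pre_digraph \<Rightarrow> ('a \<Rightarrow> real) \<Rightarrow> 'a pair_pre_digraph" where
  "irregular_subgraph G x =
     \<lparr> pverts = pverts G, parcs = {(u, v) \<in> parcs G. x u + x v \<ge> 1} \<rparr>"

lemma prob_space_weight_space: "prob_space (weight_space G)"
  unfolding weight_space_def
  by (intro prob_space_PiM prob_space_uniform_measure) auto

lemma pair_graph_irregular_subgraph:
  assumes "pair_graph G"
  shows "pair_graph (irregular_subgraph G x)"
proof -
  interpret pair_graph G by fact
  have fin: "finite {(u, v) \<in> parcs G. 1 \<le> x u + x v}"
    by (rule finite_subset[OF _ pair_finite_arcs]) auto
  show ?thesis
    by unfold_locales
       (use fin in_arcsD1 in_arcsD2 no_loops' arcs_symmetric in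
         \<open>auto simp: irregular_subgraph_def symmetric_def sym_def add.commute arcs_ends_def arc_to_ends_def image_iff\<close>)
qed

lemma num_degree_irregular_subgraph_measurable:
  assumes "pair_graph G"
  shows "(\<lambda>x. real (num_degree (irregular_subgraph G x) k)) \<in> borel_measurable (weight_space G)"
proof -
  interpret pair_graph G by fact
  let ?M = "weight_space G"
  let ?N = "\<lambda>v. {w \<in> pverts G. (v, w) \<in> parcs G}"
  have comp: "(\<lambda>x. x v) \<in> borel_measurable ?M" if "v \<in> pverts G" for v
    unfolding weight_space_def
    using measurable_component_singleton[OF that, of "\<lambda>_. uniform_measure lborel {0..1::real}"]
    by (simp cong: measurable_cong_sets)
  have deg: "real (vertex_degree (irregular_subgraph G x) v) = (\<Sum>w\<in>?N v. if 1 \<le> x v + x w then 1 else 0)"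
    for x v
  proof -
    have "out_arcs (with_proj (irregular_subgraph G x)) v = Pair v ` {w \<in> ?N v. 1 \<le> x v + x w}"
      by (auto simp: out_arcs_def irregular_subgraph_def dest: in_arcsD2)
    then have "vertex_degree (irregular_subgraph G x) v = card {w \<in> ?N v. 1 \<le> x v + x w}"
      by (simp add: vertex_degree_def out_degree_def card_image inj_on_def)
    then show ?thesis
      by (simp add: sum.If_cases Int_def)
  qed
  have degm: "(\<lambda>x. real (vertex_degree (irregular_subgraph G x) v)) \<in> borel_measurable ?M"
    if "v \<in> pverts G" for v
    unfolding deg
  proof (intro borel_measurable_sum)
    fix w assume "w \<in> ?N v"
    then have [measurable]: "(\<lambda>x. x v) \<in> borel_measurable ?M" "(\<lambda>x. x w) \<in> borel_measurable ?M"
      using comp that by auto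
    show "(\<lambda>x. if 1 \<le> x v + x w then 1 else 0 :: real) \<in> borel_measurable ?M"
      by measurable
  qed
  have "real (num_degree (irregular_subgraph G x) k)
      = (\<Sum>v\<in>pverts G. if real (vertex_degree (irregular_subgraph G x) v) = real k then 1 else 0)" for x
    by (simp add: num_degree_def sum.If_cases Int_def) (simp add: irregular_subgraph_def)
  moreover have "(\<lambda>x. \<Sum>v\<in>pverts G. if real (vertex_degree (irregular_subgraph G x) v) = real k then 1 else 0 :: real)
      \<in> borel_measurable ?M"
  proof (intro borel_measurable_sum)
    fix v assume "v \<in> pverts G"
    note [measurable] = degm[OF this]
    show "(\<lambda>x. if real (vertex_degree (irregular_subgraph G x) v) = real k then 1 else 0 :: real)
        \<in> borel_measurable ?M"
      by measurable
  qed
  ultimately show ?thesis by simp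
qed

end

theory Submission
  imports Defs
begin

text \<open>
  Write \<open>X\<close> as the sum of the indicators of \<open>deg v = k\<close> and bound the covariances. Given the weights
  of the neighbours of \<open>v\<close>, the weights \<open>x v\<close> that give \<open>v\<close> degree \<open>k\<close> form the gap between two
  consecutive order statistics of \<open>d\<close> uniform points; such a gap has mean \<open>1/(d+1)\<close> and second
  moment \<open>2/((d+1)(d+2))\<close>. This settles the diagonal terms and, by AM-GM, the adjacent pairs.

  For non-adjacent \<open>u\<close> and \<open>v\<close> with set \<open>C\<close> of \<open>c\<close> common neighbours, the covariance is the
  variance of the conditional expectation of a gap given the points in \<open>C\<close>. A gap is a symmetric
  function of \<open>d\<close> independent points, of which one can choose \<open>d div c\<close> disjoint blocks of size \<open>c\<close>; the
  conditional expectations given these blocks are uncorrelated, so by Bessel's inequality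
  \<open>d div c\<close> times the covariance is at most the variance of the gap. Hence the covariance is
  \<open>O(c/d\<^sup>3)\<close>, and the numbers \<open>c\<close> add up to \<open>d\<^sup>2\<close> for fixed \<open>v\<close>.
\<close>

section \<open>The uniform distribution on the unit interval\<close>

abbreviation unif :: "real measure" where "unif \<equiv> uniform_measure lborel {0..1}"
abbreviation weights :: "'a set \<Rightarrow> ('a \<Rightarrow> real) measure" where "weights I \<equiv> PiM I (\<lambda>_. unif)"

lemma prob_space_unif: "prob_space unif" by (intro prob_space_uniform_measure) auto
interpretation unif: prob_space unif by (rule prob_space_unif)
interpretation weights: product_sigma_finite "\<lambda>_. unif" by standard

lemma integral_unif:
  fixes f :: "real \<Rightarrow> real"
  assumes "f \<in> borel_measurable borel"
  shows "(\<integral>t. f t \<partial>unif) = (\<integral>t. indicator {0..1} t * f t \<partial>lborel)"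
proof -
  have "unif = density lborel (\<lambda>t. ennreal (indicator {0..1} t))"
    by (simp add: uniform_measure_def ennreal_indicator divide_ennreal_def)
  then show ?thesis using assms by (simp add: integral_real_density)
qed

lemma AE_unif: "AE t in unif. 0 \<le> t \<and> t \<le> 1"
  by (rule AE_uniform_measureI) auto

text \<open>Exact values come from Henstock-Kurzweil integrals over \<open>{0..1}\<close>.
  Nonnegativity allows the passage to the Lebesgue integral through \<open>nn_integral\<close>, with
  no separate proof of integrability.\<close>

lemma has_integral_unif:
  fixes f :: "real \<Rightarrow> real"
  assumes "f \<in> borel_measurable borel" "\<And>t. 0 \<le> t \<Longrightarrow> t \<le> 1 \<Longrightarrow> 0 \<le> f t" "(f has_integral c) {0..1}"
  shows "(\<integral>t. f t \<partial>unif) = c"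
proof -
  have "((\<lambda>t. indicator {0..1} t * f t) has_integral c) UNIV"
    using assms(3) has_integral_restrict_UNIV[of "{0..1}" f c]
    by (simp add: indicator_times_eq_if(1) del: atLeastAtMost_iff)
  then have "(\<integral>\<^sup>+t. ennreal (indicator {0..1} t * f t) \<partial>lborel) = ennreal c"
    using assms(1,2) by (intro nn_integral_has_integral_lborel) (auto split: split_indicator)
  moreover have "0 \<le> c"
    using assms(2) by (intro has_integral_nonneg[OF assms(3)]) simp
  ultimately have "(\<integral>t. indicator {0..1} t * f t \<partial>lborel) = c"
    using assms(1,2) by (subst integral_eq_nn_integral) (auto split: split_indicator)
  with assms(1) show ?thesis by (simp add: integral_unif)
qed

section \<open>Bernstein polynomials and threshold functions\<close>

lemma Bernstein_measurable[measurable]: "Bernstein d k \<in> borel_measurable borel"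
  unfolding Bernstein_def by measurable

text \<open>The integral is a Beta integral, with value \<open>k! (d-k)! / (d+1)!\<close> before the
  binomial factor. This is the source of every factor \<open>1 / (d + 1)\<close> below.\<close>

lemma integral_Bernstein:
  assumes "k \<le> d"
  shows "(\<integral>t. Bernstein d k t \<partial>unif) = 1 / (real d + 1)"
proof (rule has_integral_unif)
  \<comment> \<open>The open interval avoids the endpoints, where \<open>powr\<close> and
    \<open>^\<close> can differ: \<open>0 powr 0 = 0\<close> but \<open>0 ^ 0 = 1\<close>.\<close>
  have "((\<lambda>t. t powr (real (Suc k) - 1) * (1 - t) powr (real (Suc (d - k)) - 1))
           has_integral Beta (real (Suc k)) (real (Suc (d-k)))) {0<..<1}"
    by (subst has_integral_Icc_iff_Ioo[symmetric], rule has_integral_Beta_real) auto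
  then have "((\<lambda>t. t ^ k * (1 - t) ^ (d-k))
           has_integral Beta (real (Suc k)) (real (Suc (d-k)))) {0<..<1}"
    by (rule has_integral_eq[rotated]) (auto simp: powr_realpow)
  from has_integral_mult_right[OF this, of "real (d choose k)"]
  have *: "(Bernstein d k has_integral real (d choose k) * Beta (real (Suc k)) (real (Suc (d-k))))
      {0..1}"
    by (simp add: Bernstein_def[abs_def] mult.assoc has_integral_Icc_iff_Ioo)
  have "real (Suc k) + real (Suc (d-k)) = 1 + real (Suc d)"
    using assms by simp
  then have "Beta (real (Suc k)) (real (Suc (d-k))) = fact k * fact (d-k) / fact (Suc d)"
    using Gamma_fact[of k, where 'a=real] Gamma_fact[of "d - k", where 'a=real]
      Gamma_fact[of "Suc d", where 'a=real]
    unfolding Beta_def by (simp only: of_nat_Suc)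
  then have "real (d choose k) * Beta (real (Suc k)) (real (Suc (d-k))) = 1 / (real d + 1)"
    using assms by (simp add: binomial_fact)
  with * show "(Bernstein d k has_integral 1 / (real d + 1)) {0..1}" by simp
qed (auto simp: Bernstein_nonneg)

text \<open>A uniform weight \<open>y\<close> reaches level \<open>s\<close> with probability
  \<open>s\<close>. Since \<open>s \<le> t\<close>, the combination \<open>F True False\<close>
  never occurs, so three intervals of \<open>y\<close> remain. This is the effect of one additional
  point on a pair of counts.\<close>

lemma integral_threshold:
  fixes F :: "bool \<Rightarrow> bool \<Rightarrow> real"
  assumes "0 \<le> s" "s \<le> t" "t \<le> 1"
  shows "(\<integral>y. F (1 \<le> y + s) (1 \<le> y + t) \<partial>unif)
    = s * F True True + (t - s) * F False True + (1 - t) * F False False"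
proof -
  have "(\<integral>y. F (1 \<le> y + s) (1 \<le> y + t) \<partial>unif)
      = (\<integral>y. indicator {0..1} y * F (1 \<le> y + s) (1 \<le> y + t) \<partial>lborel)"
    by (intro integral_unif) measurable
  also have "\<dots> = (\<integral>y. F True True * indicator {1-s..1} y + F False True * indicator {1-t..<1-s} y
       + F False False * indicator {0..<1-t} y \<partial>lborel)"
    using assms by (intro Bochner_Integration.integral_cong) (auto simp: indicator_def not_le)
  finally have eq: "(\<integral>y. F (1 \<le> y + s) (1 \<le> y + t) \<partial>unif) = \<dots>" .
  have "has_bochner_integral lborel
      (\<lambda>y. F True True * indicator {1-s..1} y + F False True * indicator {1-t..<1-s} y
        + F False False * indicator {0..<1-t} y)
      (F True True * measure lborel {1-s..1} + F False True * measure lborel {1-t..<1-s}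
        + F False False * measure lborel {0..<1-t})"
    using assms by (intro has_bochner_integral_add has_bochner_integral_mult_right
        has_bochner_integral_real_indicator) auto
  then have "(\<integral>y. F True True * indicator {1-s..1} y + F False True * indicator {1-t..<1-s} y
       + F False False * indicator {0..<1-t} y \<partial>lborel)
      = s * F True True + (t - s) * F False True + (1 - t) * F False False"
    using assms by (simp add: has_bochner_integral_integral_eq mult.commute)
  with eq show ?thesis by simp
qed

section \<open>Independent uniform weights\<close>

text \<open>For \<open>S\<close> the neighbourhood of a vertex of weight \<open>s\<close>, this is
  the degree of that vertex in the random subgraph. The level \<open>s\<close> is kept apart from
  \<open>x\<close> so that it can be integrated out on its own.\<close>

definition upcount :: "'a set \<Rightarrow> real \<Rightarrow> ('a \<Rightarrow> real) \<Rightarrow> nat" where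
  "upcount S s x = card {w \<in> S. 1 \<le> x w + s}"

lemma prob_space_weights: "prob_space (weights I)"
  by (intro prob_space_PiM prob_space_unif)

lemma prob_integrable_bounded:
  fixes f :: "'a \<Rightarrow> real"
  assumes "prob_space M" "f \<in> borel_measurable M" "\<And>x. \<bar>f x\<bar> \<le> B"
  shows "integrable M f"
proof -
  interpret prob_space M by fact
  show ?thesis using assms by (intro integrable_const_bound[of _ B]) auto
qed

lemma prob_Fubini_bounded:
  fixes f :: "'a \<Rightarrow> 'b \<Rightarrow> real"
  assumes "prob_space M" "prob_space N"
    and "case_prod f \<in> borel_measurable (M \<Otimes>\<^sub>M N)" "\<And>x y. \<bar>f x y\<bar> \<le> B"
  shows "(\<integral>x. \<integral>y. f x y \<partial>N \<partial>M) = (\<integral>y. \<integral>x. f x y \<partial>M \<partial>N)"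
proof -
  interpret M: prob_space M by fact
  interpret N: prob_space N by fact
  interpret pair_prob_space M N ..
  have "integrable (M \<Otimes>\<^sub>M N) (case_prod f)"
    using assms(3,4) prob_space_axioms by (intro prob_integrable_bounded[of _ _ B]) auto
  then show ?thesis by (simp add: Fubini_integral)
qed

lemma borel_measurable_prob_integral:
  fixes f :: "'a \<Rightarrow> 'b \<Rightarrow> real"
  assumes "prob_space N" "case_prod f \<in> borel_measurable (M \<Otimes>\<^sub>M N)"
  shows "(\<lambda>x. \<integral>y. f x y \<partial>N) \<in> borel_measurable M"
proof -
  interpret N: prob_space N by fact
  show ?thesis using assms(2) by (rule N.borel_measurable_lebesgue_integral)
qed

lemma upcount_insert:
  assumes "finite S" "w \<notin> S"
  shows "upcount (insert w S) s x = of_bool (1 \<le> x w + s) + upcount S s x"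
proof -
  have "{v \<in> insert w S. 1 \<le> x v + s} = (if 1 \<le> x w + s then {w} else {}) \<union> {v \<in> S. 1 \<le> x v + s}"
    by auto
  then show ?thesis using assms by (simp add: upcount_def)
qed

lemma upcount_empty [simp]: "upcount {} s x = 0"
  by (simp add: upcount_def)

lemma upcount_Un:
  assumes "finite S" "finite T" "S \<inter> T = {}"
  shows "upcount (S \<union> T) s x = upcount S s x + upcount T s x"
  using assms unfolding upcount_def
  by (subst card_Un_disjoint[symmetric]) (auto intro!: arg_cong[where f=card])

lemma upcount_cong: "(\<And>w. w \<in> S \<Longrightarrow> x w = y w) \<Longrightarrow> upcount S s x = upcount S s y"
  unfolding upcount_def by (intro arg_cong[where f=card]) auto

lemma upcount_mono: "finite S \<Longrightarrow> s \<le> t \<Longrightarrow> upcount S s x \<le> upcount S t x"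
  unfolding upcount_def by (intro card_mono) auto

lemma upcount_image:
  assumes "inj_on f J" "S \<subseteq> J"
  shows "upcount (f ` S) s x = upcount S s (\<lambda>n\<in>J. x (f n))"
proof -
  have "{w \<in> f ` S. 1 \<le> x w + s} = f ` {n \<in> S. 1 \<le> (\<lambda>n\<in>J. x (f n)) n + s}"
    using assms by auto
  moreover have "inj_on f {n \<in> S. 1 \<le> (\<lambda>n\<in>J. x (f n)) n + s}"
    using assms by (auto intro: inj_on_subset)
  ultimately show ?thesis by (simp add: upcount_def card_image)
qed

text \<open>Both the level and the weights may vary with \<open>z\<close>. This covers constant
  levels, levels that form a second factor of a product space, and the level \<open>x v\<close> read
  off from the weights.\<close>

lemma upcount_measurable:
  assumes "finite S" "S \<subseteq> I" and g: "g \<in> borel_measurable M" and f: "f \<in> measurable M (weights I)"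
  shows "(\<lambda>z. upcount S (g z) (f z)) \<in> measurable M (count_space UNIV)"
  using assms(1,2)
proof (induction S)
  case (insert w S)
  have [measurable]: "(\<lambda>z. f z w) \<in> borel_measurable M"
    using measurable_compose[OF f measurable_component_singleton[of w I "\<lambda>_. unif"]] insert.prems
    by (simp cong: measurable_cong_sets)
  have [measurable]: "(\<lambda>z. upcount S (g z) (f z)) \<in> measurable M (count_space UNIV)"
    using insert by auto
  note [measurable] = g
  have "(\<lambda>z. if 1 \<le> f z w + g z then Suc (upcount S (g z) (f z)) else upcount S (g z) (f z))
      \<in> measurable M (count_space UNIV)"
    by measurable
  also have "(\<lambda>z. if 1 \<le> f z w + g z then Suc (upcount S (g z) (f z)) else upcount S (g z) (f z))
     = (\<lambda>z. upcount (insert w S) (g z) (f z))"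
    using insert by (auto simp: upcount_insert)
  finally show ?case .
qed simp

lemma upcount_measurable_const:
  assumes "finite S" and g: "g \<in> borel_measurable M"
  shows "(\<lambda>z. upcount S (g z) x) \<in> measurable M (count_space UNIV)"
proof -
  \<comment> \<open>The space of \<open>weights S\<close> contains only extensional functions, so an
    arbitrary \<open>x\<close> is first restricted to \<open>S\<close>.\<close>
  have "upcount S t x = upcount S t (restrict x S)" for t
    by (intro upcount_cong) auto
  then show ?thesis
    using upcount_measurable[OF assms(1) order_refl g, of "\<lambda>_. restrict x S"]
    by (simp add: space_PiM)
qed

text \<open>The index of the polynomial depends on \<open>z\<close> too, but takes only the values
  \<open>k - j\<close> with \<open>j \<le> k\<close>; a finite sum over \<open>j\<close> separates
  them.\<close>

lemma Bernstein_upcount_measurable: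
  assumes [measurable]: "N \<in> measurable M (count_space UNIV)" "g \<in> borel_measurable M"
  shows "(\<lambda>z. if N z \<le> k then Bernstein m (k - N z) (g z) else 0) \<in> borel_measurable M"
proof -
  have "(\<lambda>z. \<Sum>j\<le>k. of_bool (N z = j) * Bernstein m (k - j) (g z)) \<in> borel_measurable M"
    by measurable
  also have "(\<lambda>z. \<Sum>j\<le>k. of_bool (N z = j) * Bernstein m (k - j) (g z))
     = (\<lambda>z. if N z \<le> k then Bernstein m (k - N z) (g z) else 0)"
    by (auto simp: fun_eq_iff of_bool_def if_distrib[of "\<lambda>a. a * _"] sum.delta' cong: if_cong)
  finally show ?thesis .
qed

lemma integral_weights_merge:
  fixes f :: "('a \<Rightarrow> real) \<Rightarrow> real"
  assumes "finite I" "B \<subseteq> I" "f \<in> borel_measurable (weights I)" "\<And>x. \<bar>f x\<bar> \<le> 1"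
  shows "(\<integral>x. f x \<partial>weights I)
    = (\<integral>x. \<integral>y. f (merge (I - B) B (x, y)) \<partial>weights B \<partial>weights (I - B))"
proof -
  have "I = (I - B) \<union> B" "finite B" using assms finite_subset by auto
  then show ?thesis
    using weights.product_integral_fold[of "I - B" B f] assms
    by (auto intro!: prob_integrable_bounded[of _ _ 1] prob_space_weights)
qed

text \<open>Independent identically distributed weights stay so under an injective relabelling. This
  makes it possible to move sets of points into \<open>{..<d}\<close>.\<close>

lemma integral_reindex:
  fixes F :: "('a \<Rightarrow> real) \<Rightarrow> real"
  assumes "inj_on f J" "f \<in> J \<rightarrow> I" "F \<in> borel_measurable (weights J)"
  shows "(\<integral>x. F (\<lambda>n\<in>J. x (f n)) \<partial>weights I) = (\<integral>x. F x \<partial>weights J)"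
proof -
  have "(\<integral>x. F x \<partial>weights J) = (\<integral>x. F x \<partial>distr (weights I) (weights J) (\<lambda>x. \<lambda>n\<in>J. x (f n)))"
    using distr_PiM_reindex[of I "\<lambda>_. unif" f J] assms(1,2) prob_space_unif by simp
  also have "\<dots> = (\<integral>x. F (\<lambda>n\<in>J. x (f n)) \<partial>weights I)"
    using assms(2,3) by (intro integral_distr)
        (auto intro!: measurable_restrict measurable_component_singleton)
  finally show ?thesis by simp
qed

text \<open>Both counts equal \<open>k\<close> exactly when \<open>k\<close> of the points
  \<open>1 - x w\<close> are at most \<open>s\<close> and all others exceed \<open>t\<close>; the
  value is the corresponding multinomial probability. The induction integrates out one weight at a
  time.\<close>

lemma integral_upcount_pair:
  assumes "finite S" "0 \<le> s" "s \<le> t" "t \<le> 1"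
  shows "(\<integral>x. of_bool (upcount S s x = k \<and> upcount S t x = k) \<partial>weights S)
    = real (card S choose k) * s ^ k * (1 - t) ^ (card S - k)"
  using assms(1)
proof (induction S arbitrary: k)
  case empty
  interpret P0: prob_space "weights {} :: ('a \<Rightarrow> real) measure" by (rule prob_space_weights)
  show ?case by (cases k) (simp_all add: P0.prob_space)
next
  case (insert w S)
  interpret PS: prob_space "weights S" by (rule prob_space_weights)
  define f :: "nat \<Rightarrow> ('a \<Rightarrow> real) \<Rightarrow> real"
    where "f = (\<lambda>k x. of_bool (upcount S s x = k \<and> upcount S t x = k))"
  have m: "(\<lambda>x. of_bool (upcount T s x = k \<and> upcount T t x = k) :: real)
      \<in> borel_measurable (weights T)"
    if "finite T" for T :: "'a set" and k
  proof -
    note [measurable] = upcount_measurable[OF that order_refl]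
    show ?thesis by measurable
  qed
  have int: "integrable (weights S) (f k)" for k
    unfolding f_def using insert m
    by (intro prob_integrable_bounded[of _ _ 1] prob_space_weights) auto
  have IH: "(\<integral>x. f k x \<partial>weights S) = real (card S choose k) * s ^ k * (1 - t) ^ (card S - k)" for k
    unfolding f_def by (rule insert.IH)
  have I: "integrable (weights (insert w S))
      (\<lambda>x. of_bool (upcount (insert w S) s x = k \<and> upcount (insert w S) t x = k) :: real)"
    using insert.hyps by (intro prob_integrable_bounded[of _ _ 1] prob_space_weights m) auto
  have "(\<integral>x. of_bool (upcount (insert w S) s x = k \<and> upcount (insert w S) t x = k)
      \<partial>weights (insert w S))
    = (\<integral>x. \<integral>y. (of_bool (upcount (insert w S) s (x(w := y)) = k
        \<and> upcount (insert w S) t (x(w := y)) = k) :: real) \<partial>unif \<partial>weights S)"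
    using weights.product_integral_insert[OF insert.hyps I] .
  also have "\<dots> = (\<integral>x. (if k = 0 then 0 else s * f (k - 1) x) + (1 - t) * f k x \<partial>weights S)"
  proof (intro Bochner_Integration.integral_cong refl)
    fix x
    have c: "upcount S s' (x(w := y)) = upcount S s' x" for s' y
      using insert by (intro upcount_cong) auto
    have "(\<integral>y. (of_bool (upcount (insert w S) s (x(w := y)) = k
        \<and> upcount (insert w S) t (x(w := y)) = k) :: real) \<partial>unif)
      = (\<integral>y. (\<lambda>a b. of_bool (of_bool a + upcount S s x = k \<and> of_bool b + upcount S t x = k) :: real)
          (1 \<le> y + s) (1 \<le> y + t) \<partial>unif)"
      using insert by (simp add: upcount_insert c)
    also have "\<dots> = s * of_bool (Suc (upcount S s x) = k \<and> Suc (upcount S t x) = k)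
       + (t - s) * of_bool (upcount S s x = k \<and> Suc (upcount S t x) = k)
       + (1 - t) * of_bool (upcount S s x = k \<and> upcount S t x = k)"
      using assms by (subst integral_threshold) auto
    \<comment> \<open>A new point between the two levels raises only the count at \<open>t\<close>,
      which is already at least the count at \<open>s\<close>, so the counts can no longer
      agree.\<close>
    also have "(upcount S s x = k \<and> Suc (upcount S t x) = k) = False"
      using upcount_mono[of S s t x] insert assms by auto
    finally show "(\<integral>y. (of_bool (upcount (insert w S) s (x(w := y)) = k
        \<and> upcount (insert w S) t (x(w := y)) = k) :: real) \<partial>unif)
      = (if k = 0 then 0 else s * f (k - 1) x) + (1 - t) * f k x"
      unfolding f_def by (cases k) (simp_all del: fun_upd_apply)
  qed
  also have "\<dots> = (if k = 0 then 0 else s * (\<integral>x. f (k - 1) x \<partial>weights S))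
      + (1 - t) * (\<integral>x. f k x \<partial>weights S)"
    using int by simp
  also have "\<dots> = real (card (insert w S) choose k) * s ^ k * (1 - t) ^ (card (insert w S) - k)"
  proof (cases k)
    case 0
    then show ?thesis using insert by (simp add: IH)
  next
    case (Suc j)
    \<comment> \<open>The exponent grows by one only if \<open>Suc j \<le> card S\<close>, because
      of truncated subtraction; otherwise the binomial coefficient is 0. Pascal's rule then combines
      the two terms.\<close>
    have "(1 - t) * (real (card S choose Suc j) * s ^ Suc j * (1 - t) ^ (card S - Suc j))
       = real (card S choose Suc j) * s ^ Suc j * (1 - t) ^ (card S - j)"
    proof (cases "Suc j \<le> card S")
      case True
      then have "card S - j = Suc (card S - Suc j)" by auto
      then show ?thesis by simp
    qed (simp add: binomial_eq_0)
    then have "s * (\<integral>x. f j x \<partial>weights S) + (1 - t) * (\<integral>x. f (Suc j) x \<partial>weights S)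
       = s * (real (card S choose j) * s ^ j * (1 - t) ^ (card S - j))
         + real (card S choose Suc j) * s ^ Suc j * (1 - t) ^ (card S - j)"
      by (simp only: IH)
    then show ?thesis using insert.hyps Suc by (simp add: algebra_simps)
  qed
  finally show ?case .
qed

lemma integral_upcount:
  assumes "finite S" "0 \<le> s" "s \<le> 1"
  shows "(\<integral>x. of_bool (upcount S s x = k) \<partial>weights S) = Bernstein (card S) k s"
  using integral_upcount_pair[of S s s k] assms by (simp add: Bernstein_def)

section \<open>Gaps and their conditional expectations\<close>

text \<open>
  \<open>gap k S x\<close> is the length of the set of \<open>t\<close> for which exactly \<open>k\<close> of the points \<open>1 - x w\<close>,
  \<open>w \<in> S\<close>, are at most \<open>t\<close>. \<open>cgap k m S x\<close> is the conditional expectation of the gap when \<open>m\<close>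
  further independent points are added to those of \<open>S\<close>.
\<close>

definition gap :: "nat \<Rightarrow> 'a set \<Rightarrow> ('a \<Rightarrow> real) \<Rightarrow> real" where
  "gap k S x = (\<integral>t. of_bool (upcount S t x = k) \<partial>unif)"

definition cgap :: "nat \<Rightarrow> nat \<Rightarrow> 'a set \<Rightarrow> ('a \<Rightarrow> real) \<Rightarrow> real" where
  "cgap k m S x =
     (\<integral>t. (if upcount S t x \<le> k then Bernstein m (k - upcount S t x) t else 0) \<partial>unif)"

lemma prob_integral_bounds:
  fixes f :: "'a \<Rightarrow> real"
  assumes "prob_space M" "AE x in M. 0 \<le> f x \<and> f x \<le> 1"
  shows "0 \<le> (\<integral>x. f x \<partial>M) \<and> (\<integral>x. f x \<partial>M) \<le> 1"
proof -
  interpret prob_space M by fact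
  have "AE x in M. 0 \<le> f x" using assms(2) by eventually_elim simp
  moreover have "(\<integral>x. f x \<partial>M) \<le> 1" if "integrable M f"
    using assms(2) by (intro integral_le_const that) auto
  \<comment> \<open>A function that is not integrable has integral 0 by convention, which also lies
    between 0 and 1.\<close>
  ultimately show ?thesis
    using not_integrable_integral_eq[of M f] by (cases "integrable M f")
        (auto intro: integral_nonneg_AE)
qed

lemma Bernstein_le_1:
  assumes "0 \<le> t" "t \<le> 1"
  shows "Bernstein m j t \<le> 1"
proof (cases "j \<le> m")
  case True
  then have "Bernstein m j t \<le> (\<Sum>j\<le>m. Bernstein m j t)"
    using assms by (intro member_le_sum) (auto simp: Bernstein_nonneg)
  then show ?thesis by simp
qed (simp add: Bernstein_def binomial_eq_0)

lemma gap_bounds: "0 \<le> gap k S x" "gap k S x \<le> 1"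
  using prob_integral_bounds[OF prob_space_unif, of "\<lambda>t. of_bool (upcount S t x = k)"]
  by (auto simp: gap_def)

lemma cgap_bounds: "0 \<le> cgap k m S x" "cgap k m S x \<le> 1"
proof -
  have "AE t in unif. 0 \<le> (if upcount S t x \<le> k then Bernstein m (k - upcount S t x) t else 0)
     \<and> (if upcount S t x \<le> k then Bernstein m (k - upcount S t x) t else 0) \<le> 1"
    using AE_unif by eventually_elim (auto simp: Bernstein_nonneg Bernstein_le_1)
  from prob_integral_bounds[OF prob_space_unif this]
  show "0 \<le> cgap k m S x" "cgap k m S x \<le> 1" unfolding cgap_def by auto
qed

lemma gap_cong: "(\<And>w. w \<in> S \<Longrightarrow> x w = y w) \<Longrightarrow> gap k S x = gap k S y"
  unfolding gap_def using upcount_cong[of S x y] by simp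

lemma cgap_cong: "(\<And>w. w \<in> S \<Longrightarrow> x w = y w) \<Longrightarrow> cgap k m S x = cgap k m S y"
  unfolding cgap_def using upcount_cong[of S x y] by (simp cong: if_cong)

lemma cgap_image:
  assumes "inj_on f J" "S \<subseteq> J"
  shows "cgap k m (f ` S) x = cgap k m S (\<lambda>n\<in>J. x (f n))"
  unfolding cgap_def by (simp only: upcount_image[OF assms])

lemma measurable_snd_unif: "snd \<in> borel_measurable (M \<Otimes>\<^sub>M unif)"
proof -
  have "snd \<in> measurable (M \<Otimes>\<^sub>M unif) unif" by (rule measurable_snd)
  then show ?thesis by (simp cong: measurable_cong_sets)
qed

lemma upcount_pair_measurable:
  assumes "finite S" "S \<subseteq> I"
  shows "(\<lambda>(x, t). upcount S t x) \<in> measurable (weights I \<Otimes>\<^sub>M unif) (count_space UNIV)"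
  unfolding case_prod_beta
  by (intro upcount_measurable[OF assms] measurable_snd_unif measurable_fst)

lemma gap_pair_measurable:
  assumes "finite S" "S \<subseteq> I"
  shows "(\<lambda>(x, t). of_bool (upcount S t x = k) :: real) \<in> borel_measurable (weights I \<Otimes>\<^sub>M unif)"
  using upcount_pair_measurable[OF assms] unfolding case_prod_beta by measurable

lemma cgap_pair_measurable:
  assumes "finite S" "S \<subseteq> I"
  shows "(\<lambda>(x, t). if upcount S t x \<le> k then Bernstein m (k - upcount S t x) t else 0)
     \<in> borel_measurable (weights I \<Otimes>\<^sub>M unif)"
  unfolding case_prod_beta
  using upcount_pair_measurable[OF assms]
  by (intro Bernstein_upcount_measurable) (auto simp: case_prod_beta intro: measurable_snd_unif)

lemma gap_measurable:
  assumes "finite S" "S \<subseteq> I"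
  shows "gap k S \<in> borel_measurable (weights I)"
  using borel_measurable_prob_integral[OF prob_space_unif gap_pair_measurable[OF assms, of k]]
  by (simp add: gap_def[abs_def])

lemma cgap_measurable:
  assumes "finite S" "S \<subseteq> I"
  shows "cgap k m S \<in> borel_measurable (weights I)"
  using borel_measurable_prob_integral[OF prob_space_unif cgap_pair_measurable[OF assms, of k m]]
  by (simp add: cgap_def[abs_def])

text \<open>The law of \<open>cgap k m C\<close> depends on \<open>C\<close> only through its size,
  since a bijection between the point sets preserves the product measure. It is applied with
  \<open>F\<close> the identity and the square.\<close>

lemma integral_cgap_eq:
  assumes "finite C" "finite C'" "card C = card C'" "C \<subseteq> I" "C' \<subseteq> I'"
    and "F \<in> borel_measurable borel"
  shows "(\<integral>x. (F (cgap k m C x) :: real) \<partial>weights I) = (\<integral>x. F (cgap k m C' x) \<partial>weights I')"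
proof -
  obtain f where f: "bij_betw f C C'" using finite_same_card_bij assms by metis
  note m = measurable_compose[OF cgap_measurable[OF assms(1) order_refl] assms(6)]
  \<comment> \<open>Writing the projection to \<open>C\<close> as relabelling by \<open>id\<close>
    reduces the change of ambient index set to \<open>integral_reindex\<close>.\<close>
  have "(\<integral>x. F (cgap k m C x) \<partial>weights I) = (\<integral>x. F (cgap k m C (\<lambda>n\<in>C. x (id n))) \<partial>weights I)"
    by (intro Bochner_Integration.integral_cong refl arg_cong[of _ _ F] cgap_cong) auto
  also have "\<dots> = (\<integral>x. F (cgap k m C x) \<partial>weights C)"
    using assms by (intro integral_reindex m) auto
  also have "\<dots> = (\<integral>x. F (cgap k m C (\<lambda>n\<in>C. x (f n))) \<partial>weights I')"
    using assms f by (intro integral_reindex[symmetric] m) (auto simp: bij_betw_def)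
  also have "\<dots> = (\<integral>x. F (cgap k m C' x) \<partial>weights I')"
    using f cgap_image[of f C C k m] by (simp add: bij_betw_def)
  finally show ?thesis .
qed

text \<open>This is the defining property of conditional expectation: \<open>G\<close> is a function
  of the weights outside \<open>B\<close>, and averaging the gap over the weights in
  \<open>B\<close> gives \<open>cgap\<close>.\<close>

lemma integral_mult_gap:
  assumes I: "finite I" "C \<subseteq> I" "B \<subseteq> I" "C \<inter> B = {}"
    and G: "G \<in> borel_measurable (weights I)" "\<And>x. \<bar>G x\<bar> \<le> 1"
    and dep: "\<And>x y. (\<And>w. w \<in> I - B \<Longrightarrow> x w = y w) \<Longrightarrow> G x = G y"
  shows "(\<integral>x. G x * gap k (C \<union> B) x \<partial>weights I) = (\<integral>x. G x * cgap k (card B) C x \<partial>weights I)"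
proof -
  have fin: "finite C" "finite B" using I finite_subset by metis+
  note fold = integral_weights_merge[OF I(1,3)]
  have B: "(\<integral>y. gap k (C \<union> B) (merge (I - B) B (x, y)) \<partial>weights B) = cgap k (card B) C x" for x
  proof -
    have cnt: "upcount (C \<union> B) t (merge (I - B) B (x, y)) = upcount C t x + upcount B t y" for t y
    proof -
      have "upcount (C \<union> B) t (merge (I - B) B (x, y))
          = upcount C t (merge (I - B) B (x, y)) + upcount B t (merge (I - B) B (x, y))"
        using fin I by (intro upcount_Un) auto
      also have "upcount C t (merge (I - B) B (x, y)) = upcount C t x"
        using I by (intro upcount_cong) (auto simp: merge_def)
      also have "upcount B t (merge (I - B) B (x, y)) = upcount B t y"
        using I by (intro upcount_cong) (auto simp: merge_def)
      finally show ?thesis .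
    qed
    have fst: "fst \<in> borel_measurable (unif \<Otimes>\<^sub>M weights B)"
      using measurable_fst[of unif "weights B"] by (simp cong: measurable_cong_sets)
    note [measurable] = upcount_measurable_const[OF fin(1) measurable_snd_unif]
      upcount_measurable_const[OF fin(1) fst] upcount_measurable[OF fin(2) order_refl fst
          measurable_snd]
    note [measurable] = upcount_pair_measurable[OF fin(2) order_refl]
    have "(\<integral>y. gap k (C \<union> B) (merge (I - B) B (x, y)) \<partial>weights B)
      = (\<integral>y. \<integral>t. of_bool (upcount C t x + upcount B t y = k) \<partial>unif \<partial>weights B)"
      by (simp add: gap_def cnt)
    \<comment> \<open>After the exchange \<open>t\<close> is fixed in the inner integral, which is
      the binomial probability that \<open>B\<close> supplies the missing
      \<open>k - upcount C t x\<close> points. It is 0 if \<open>C\<close> already supplies more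
      than \<open>k\<close>.\<close>
    also have "\<dots> = (\<integral>t. \<integral>y. of_bool (upcount C t x + upcount B t y = k) \<partial>weights B \<partial>unif)"
      by (intro prob_Fubini_bounded[of _ _ _ 1] prob_space_weights prob_space_unif)
         (auto simp: case_prod_beta')
    also have "\<dots> = cgap k (card B) C x"
      unfolding cgap_def
    proof (intro integral_cong_AE)
      show "AE t in unif. (\<integral>y. of_bool (upcount C t x + upcount B t y = k) \<partial>weights B)
        = (if upcount C t x \<le> k then Bernstein (card B) (k - upcount C t x) t else 0)"
        using AE_unif
      proof eventually_elim
        case (elim t)
        have "of_bool (upcount C t x + upcount B t y = k)
          = (if upcount C t x \<le> k then of_bool (upcount B t y = k - upcount C t x) else 0 :: real)" for y
          by auto
        then show ?case using elim fin by (simp add: integral_upcount)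
      qed
    next
      show "(\<lambda>t. if upcount C t x \<le> k then Bernstein (card B) (k - upcount C t x) t else 0)
        \<in> borel_measurable unif"
        using fin by (intro Bernstein_upcount_measurable upcount_measurable_const) auto
    next
      show "(\<lambda>t. \<integral>y. (of_bool (upcount C t x + upcount B t y = k) :: real) \<partial>weights B)
          \<in> borel_measurable unif"
        by (rule borel_measurable_prob_integral[OF prob_space_weights]) (simp add: case_prod_beta')
    qed
    finally show ?thesis .
  qed
  \<comment> \<open>Both \<open>G\<close> and \<open>cgap\<close> are constant in the weights of
    \<open>B\<close>, so the two integrals over \<open>I\<close> reduce to the same integral over
    \<open>I - B\<close>.\<close>
  have Gm: "G (merge (I - B) B (x, y)) = G x" for x y
    by (intro dep) (auto simp: merge_def)
  have Cm: "cgap k (card B) C (merge (I - B) B (x, y)) = cgap k (card B) C x" for x y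
    using I by (intro cgap_cong) (auto simp: merge_def)
  interpret PB: prob_space "weights B" by (rule prob_space_weights)
  have "(\<integral>x. G x * gap k (C \<union> B) x \<partial>weights I) = (\<integral>x. G x * cgap k (card B) C x \<partial>weights (I - B))"
    using I fin G
    by (subst fold) (auto simp: Gm B abs_mult gap_bounds
        intro!: mult_le_one borel_measurable_times gap_measurable)
  also have "\<dots> = (\<integral>x. G x * cgap k (card B) C x \<partial>weights I)"
    using I fin G
    by (intro sym[OF trans[OF fold]]) (auto simp: Gm Cm PB.prob_space abs_mult cgap_bounds
        intro!: mult_le_one borel_measurable_times cgap_measurable)
  finally show ?thesis .
qed

text \<open>With no further points the Bernstein factor is 1 at index 0 and 0 at every other index.
  Results on \<open>cgap\<close> thereby apply to \<open>gap\<close>.\<close>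

lemma gap_eq_cgap: "gap k S = cgap k 0 S"
proof -
  have "of_bool (upcount S t x = k)
      = (if upcount S t x \<le> k then Bernstein 0 (k - upcount S t x) t else 0)" for t x
    by (rule linorder_cases[of "upcount S t x" k]) (simp_all add: Bernstein_def binomial_eq_0)
  then show ?thesis by (intro ext) (simp only: gap_def cgap_def)
qed

section \<open>First and second moments of gaps\<close>

lemma integral_gap:
  assumes "finite I" "S \<subseteq> I" "k \<le> card S"
  shows "(\<integral>x. gap k S x \<partial>weights I) = 1 / (real (card S) + 1)"
proof -
  have fin: "finite S" using assms finite_subset by metis
  have "(\<integral>x. gap k S x \<partial>weights I) = (\<integral>x. gap k S x \<partial>weights S)"
    using integral_cgap_eq[of S S I S "\<lambda>x. x"] assms fin by (simp add: gap_eq_cgap)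
  \<comment> \<open>At a fixed level the count is binomial, so the mean becomes the integral of a
    Bernstein polynomial.\<close>
  also have "\<dots> = (\<integral>t. \<integral>x. of_bool (upcount S t x = k) \<partial>weights S \<partial>unif)"
    unfolding gap_def using gap_pair_measurable[OF fin order_refl]
    by (intro prob_Fubini_bounded[of _ _ _ 1] prob_space_weights prob_space_unif) auto
  also have "\<dots> = (\<integral>t. Bernstein (card S) k t \<partial>unif)"
  proof (intro integral_cong_AE)
    have "fst \<in> borel_measurable (unif \<Otimes>\<^sub>M weights S)"
      using measurable_fst[of unif "weights S"] by (simp cong: measurable_cong_sets)
    from upcount_measurable[OF fin order_refl this measurable_snd]
    show "(\<lambda>t. \<integral>x. (of_bool (upcount S t x = k) :: real) \<partial>weights S) \<in> borel_measurable unif"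
      by (intro borel_measurable_prob_integral[OF prob_space_weights]) (simp add: case_prod_beta')
    show "AE t in unif. (\<integral>x. of_bool (upcount S t x = k) \<partial>weights S) = Bernstein (card S) k t"
      using AE_unif by eventually_elim (simp add: integral_upcount fin)
  qed simp
  also have "\<dots> = 1 / (real (card S) + 1)" by (rule integral_Bernstein) fact
  finally show ?thesis .
qed

text \<open>The tower property: \<open>integral_mult_gap\<close> with constant factor 1. The points
  are first moved into \<open>{..<c+m}\<close>, because \<open>I\<close> may have no room for
  \<open>m\<close> points besides \<open>C\<close>.\<close>

lemma integral_cgap:
  assumes "finite I" "C \<subseteq> I" "k \<le> card C + m"
  shows "(\<integral>x. cgap k m C x \<partial>weights I) = 1 / (real (card C + m) + 1)"
proof -
  define c where "c = card C"
  have fin: "finite C" using assms finite_subset by metis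
  have "(\<integral>x. cgap k m C x \<partial>weights I) = (\<integral>x. cgap k m {..<c} x \<partial>weights {..<c+m})"
    by (rule integral_cgap_eq[of C "{..<c}" I "{..<c+m}" "\<lambda>x. x"])
       (use fin assms(2) in \<open>simp_all add: c_def\<close>)
  also have "\<dots> = (\<integral>x. gap k ({..<c} \<union> {c..<c+m}) x \<partial>weights {..<c+m})"
  proof -
    have "(\<integral>x. 1 * gap k ({..<c} \<union> {c..<c+m}) x \<partial>weights {..<c+m})
      = (\<integral>x. 1 * cgap k (card {c..<c+m}) {..<c} x \<partial>weights {..<c+m})"
      by (rule integral_mult_gap) auto
    then show ?thesis by simp
  qed
  also have "{..<c} \<union> {c..<c+m} = {..<c+m}" by auto
  also have "(\<integral>x. gap k {..<c+m} x \<partial>weights {..<c+m}) = 1 / (real (card C + m) + 1)"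
    using integral_gap[of "{..<c+m}" "{..<c+m}" k] assms(3) by (simp add: c_def)
  finally show ?thesis .
qed

lemma prob_abs_integral_le:
  fixes f :: "'a \<Rightarrow> real"
  assumes "prob_space M" "\<And>x. \<bar>f x\<bar> \<le> B"
  shows "\<bar>\<integral>x. f x \<partial>M\<bar> \<le> B"
proof (cases "integrable M f")
  case True
  interpret prob_space M by fact
  have "\<bar>\<integral>x. f x \<partial>M\<bar> \<le> (\<integral>x. \<bar>f x\<bar> \<partial>M)" by (rule integral_abs_bound)
  also have "\<dots> \<le> B" using True assms(2) by (intro integral_le_const) auto
  finally show ?thesis .
next
  case False
  then show ?thesis using assms(2)[of undefined] by (simp add: not_integrable_integral_eq)
qed

lemma upcount_pair_event_measurable:
  assumes "finite S" "f \<in> measurable M (weights S)" "g \<in> measurable M unif" "h \<in> measurable M unif"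
  shows "(\<lambda>z. of_bool (upcount S (g z) (f z) = k \<and> upcount S (h z) (f z) = k) :: real)
    \<in> borel_measurable M"
proof -
  have "g \<in> borel_measurable M" "h \<in> borel_measurable M"
    using assms by (simp_all cong: measurable_cong_sets)
  from this[THEN upcount_measurable[OF assms(1) order_refl _ assms(2)]]
  show ?thesis by measurable
qed

lemma integral_one_minus_power:
  assumes "0 \<le> s" "s \<le> 1"
  shows "(\<integral>t. (if s \<le> t \<and> t \<le> 1 then (1 - t) ^ n else 0) \<partial>unif) = (1 - s) ^ Suc n / real (Suc n)"
proof (rule has_integral_unif)
  have "((\<lambda>t. (1 - t) ^ n) has_integral
      (- ((1 - 1) ^ Suc n / real (Suc n))) - (- ((1 - s) ^ Suc n / real (Suc n)))) {s..1}"
    using assms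
    by (intro fundamental_theorem_of_calculus)
       (auto intro!: derivative_eq_intros simp flip: has_real_derivative_iff_has_vector_derivative
             simp: divide_simps simp del: of_nat_Suc power_Suc)
  then have "((\<lambda>t. (1 - t) ^ n) has_integral (1 - s) ^ Suc n / real (Suc n)) {s..1}"
    by simp
  moreover have "{s..1} \<subseteq> {0..1}" using assms by auto
  ultimately have "((\<lambda>t. if t \<in> {s..1} then (1 - t) ^ n else 0) has_integral
      (1 - s) ^ Suc n / real (Suc n)) {0..1}"
    by (simp only: has_integral_restrict)
  then show "((\<lambda>t. if s \<le> t \<and> t \<le> 1 then (1 - t) ^ n else 0) has_integral
      (1 - s) ^ Suc n / real (Suc n)) {0..1}"
    by simp
qed auto

text \<open>The squared gap is a double integral over levels \<open>s\<close> and \<open>t\<close>,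
  so its mean integrates the probability that both counts equal \<open>k\<close>. The halves
  \<open>s \<le> t\<close> and \<open>t \<le> s\<close> contribute equally, whence the factor 2. The
  case \<open>k > card S\<close> is included because adjacent vertices lead to it.\<close>

lemma integral_gap_sq_le:
  assumes "finite I" "S \<subseteq> I"
  shows "(\<integral>x. (gap k S x)\<^sup>2 \<partial>weights I) \<le> 2 / ((real (card S) + 1) * (real (card S) + 2))"
proof -
  have fin: "finite S" using assms finite_subset by metis
  define d where "d = card S"
  define \<phi> :: "('a \<Rightarrow> real) \<Rightarrow> real \<Rightarrow> real \<Rightarrow> real"
    where "\<phi> = (\<lambda>x s t. of_bool (upcount S s x = k \<and> upcount S t x = k))"
  define \<Phi> where "\<Phi> = (\<lambda>s t. \<integral>x. \<phi> x s t \<partial>weights S)"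
  \<comment> \<open>The cutoffs make \<open>H\<close> nonnegative and bounded on the whole plane, as
    Fubini and the integrability arguments below require.\<close>
  define H :: "real \<Rightarrow> real \<Rightarrow> real" where
    "H = (\<lambda>s t. if 0 \<le> s \<and> s \<le> t \<and> t \<le> 1 then real (d choose k) * s ^ k * (1 - t) ^ (d - k) else 0)"
  note \<phi>_m = upcount_pair_event_measurable[OF fin, of _ _ _ _ k]
  have \<phi>_bd: "\<bar>\<phi> x s t\<bar> \<le> 1" for x s t by (simp add: \<phi>_def)
  have "fst \<in> borel_measurable (unif \<Otimes>\<^sub>M unif)"
    using measurable_fst[of unif unif] by (simp cong: measurable_cong_sets)
  note [measurable] = this measurable_snd_unif[of unif]
  have H_m: "(\<lambda>p. H (fst p) (snd p)) \<in> borel_measurable (unif \<Otimes>\<^sub>M unif)"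
    "(\<lambda>p. H (snd p) (fst p)) \<in> borel_measurable (unif \<Otimes>\<^sub>M unif)"
    unfolding H_def by measurable
  have H_m1: "H s \<in> borel_measurable unif" "(\<lambda>s. H s t) \<in> borel_measurable unif" for s t
    unfolding H_def by measurable
  have H0: "0 \<le> H s t" for s t unfolding H_def by simp
  have H_bd: "\<bar>H s t\<bar> \<le> real (d choose k)" for s t
  proof -
    have "s ^ k * (1 - t) ^ (d - k) \<le> 1" if "0 \<le> s" "s \<le> t" "t \<le> 1"
      using that by (intro mult_le_one power_le_one) auto
    then show ?thesis by (auto simp: H_def abs_mult mult.assoc intro!: mult_left_le)
  qed
  have \<Phi>_m: "(\<lambda>p. \<Phi> (fst p) (snd p)) \<in> borel_measurable (unif \<Otimes>\<^sub>M unif)"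
    unfolding \<Phi>_def \<phi>_def
    by (intro borel_measurable_prob_integral[OF prob_space_weights])
       (unfold case_prod_beta', intro \<phi>_m; measurable)
  have \<Phi>_bd: "0 \<le> \<Phi> s t \<and> \<Phi> s t \<le> 1" for s t
    unfolding \<Phi>_def by (intro prob_integral_bounds prob_space_weights) (auto simp: \<phi>_def)
  \<comment> \<open>Only an inequality, since both terms on the right are present on the diagonal
    \<open>s = t\<close>.\<close>
  have \<Phi>_le: "\<Phi> s t \<le> H s t + H t s" if "0 \<le> s" "s \<le> 1" "0 \<le> t" "t \<le> 1" for s t
  proof (cases "s \<le> t")
    case True
    then have "\<Phi> s t = H s t"
      using that fin integral_upcount_pair[of S s t k] by (simp add: \<Phi>_def \<phi>_def H_def d_def)
    then show ?thesis using H0[of t s] by simp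
  next
    case False
    then have "\<Phi> s t = H t s"
      using that fin integral_upcount_pair[of S t s k]
      by (simp add: \<Phi>_def \<phi>_def H_def d_def conj_commute)
    then show ?thesis using H0[of s t] by simp
  qed
  have H_int: "(\<integral>t. H s t \<partial>unif) = of_bool (k \<le> d) * Bernstein (Suc d) k s / (real d + 1)"
    if "0 \<le> s" "s \<le> 1" for s
  proof (cases "k \<le> d")
    case True
    have "(\<integral>t. H s t \<partial>unif) = (\<integral>t. real (d choose k) * s ^ k *
        (if s \<le> t \<and> t \<le> 1 then (1 - t) ^ (d - k) else 0) \<partial>unif)"
      using that by (intro Bochner_Integration.integral_cong) (auto simp: H_def)
    also have "\<dots> = real (d choose k) * s ^ k * ((1 - s) ^ Suc (d - k) / real (Suc (d - k)))"
      using integral_one_minus_power[OF that, of "d - k"] by simp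
    \<comment> \<open>The absorption identity
      \<open>(d+1-k) * (d+1 choose k) = (d+1) * (d choose k)\<close> produces a Bernstein polynomial
      of degree \<open>d + 1\<close>, whose integral \<open>1 / (d + 2)\<close> is known.\<close>
    also have "\<dots> = Bernstein (Suc d) k s / (real d + 1)"
    proof -
      have "(Suc d - k) * (Suc d choose k) = Suc d * (d choose k)"
        using binomial_absorb_comp[of "Suc d" k] by simp
      then have "real (Suc (d - k)) * real (Suc d choose k) = (real d + 1) * real (d choose k)"
        using True by (metis Suc_diff_le of_nat_mult of_nat_Suc add.commute)
      then have *: "real (d choose k) / real (Suc (d - k)) = real (Suc d choose k) / (real d + 1)"
        by (simp add: field_simps del: binomial_Suc_Suc)
      have "real (d choose k) * s ^ k * ((1 - s) ^ Suc (d - k) / real (Suc (d - k)))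
        = (real (d choose k) / real (Suc (d - k))) * (s ^ k * (1 - s) ^ Suc (d - k))"
        by (simp only: times_divide_eq_right times_divide_eq_left mult.assoc)
      also have "\<dots> = Bernstein (Suc d) k s / (real d + 1)"
        unfolding * Bernstein_def using True
        by (simp only: Suc_diff_le times_divide_eq_left mult.assoc of_nat_id)
      finally show ?thesis .
    qed
    finally show ?thesis using True by simp
  qed (simp add: H_def binomial_eq_0 cong: if_cong)
    have int: "integrable unif (\<lambda>s. \<integral>t. f s t \<partial>unif)"
      if "(\<lambda>p. f (fst p) (snd p)) \<in> borel_measurable (unif \<Otimes>\<^sub>M unif)" "\<And>s t. \<bar>f s t\<bar> \<le> B"
      for f :: "real \<Rightarrow> real \<Rightarrow> real" and B
      using that
      by (intro prob_integrable_bounded[of _ _ B] prob_space_unif prob_abs_integral_le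
                borel_measurable_prob_integral[OF prob_space_unif]) (simp_all add: case_prod_beta')
  have "(\<integral>x. (gap k S x)\<^sup>2 \<partial>weights I) = (\<integral>x. (gap k S x)\<^sup>2 \<partial>weights S)"
    unfolding gap_eq_cgap by (rule integral_cgap_eq[of S S I S "\<lambda>x. x\<^sup>2"])
        (use assms fin in simp_all)
  also have "\<dots> = (\<integral>x. \<integral>s. \<integral>t. \<phi> x s t \<partial>unif \<partial>unif \<partial>weights S)"
    unfolding gap_def power2_eq_square \<phi>_def by (simp add: of_bool_conj)
  also have "\<dots> = (\<integral>s. \<integral>x. \<integral>t. \<phi> x s t \<partial>unif \<partial>weights S \<partial>unif)"
  proof (intro prob_Fubini_bounded[of _ _ _ 1] prob_space_weights prob_space_unif)
    show "(\<lambda>(x, s). \<integral>t. \<phi> x s t \<partial>unif) \<in> borel_measurable (weights S \<Otimes>\<^sub>M unif)"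
      unfolding case_prod_beta' \<phi>_def
      by (intro borel_measurable_prob_integral[OF prob_space_unif])
       (unfold case_prod_beta', intro \<phi>_m; measurable)
    show "\<bar>\<integral>t. \<phi> x s t \<partial>unif\<bar> \<le> 1" for x s
      using prob_integral_bounds[OF prob_space_unif, of "\<phi> x s"] by (auto simp: \<phi>_def)
  qed
  also have "\<dots> = (\<integral>s. \<integral>t. \<Phi> s t \<partial>unif \<partial>unif)"
    unfolding \<Phi>_def
  proof (intro Bochner_Integration.integral_cong refl prob_Fubini_bounded[of _ _ _ 1]
      prob_space_weights prob_space_unif \<phi>_bd)
    show "(\<lambda>(x, t). \<phi> x s t) \<in> borel_measurable (weights S \<Otimes>\<^sub>M unif)" for s
      unfolding case_prod_beta' \<phi>_def by (intro \<phi>_m; simp)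
  qed
  also have "\<dots> \<le> (\<integral>s. (\<integral>t. H s t \<partial>unif) + (\<integral>t. H t s \<partial>unif) \<partial>unif)"
  proof (rule integral_mono_AE)
    show "integrable unif (\<lambda>s. \<integral>t. \<Phi> s t \<partial>unif)"
      using \<Phi>_bd by (intro int[of _ 1] \<Phi>_m) (auto simp: abs_le_iff intro: order_trans[of "- _" 0])
    show "integrable unif (\<lambda>s. (\<integral>t. H s t \<partial>unif) + (\<integral>t. H t s \<partial>unif))"
      by (intro Bochner_Integration.integrable_add int[OF _ H_bd] H_m)
    show "AE s in unif. (\<integral>t. \<Phi> s t \<partial>unif) \<le> (\<integral>t. H s t \<partial>unif) + (\<integral>t. H t s \<partial>unif)"
      using AE_unif
    proof eventually_elim
      case (elim s)
      have h: "integrable unif (H s)" "integrable unif (\<lambda>t. H t s)"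
        by (intro prob_integrable_bounded[OF prob_space_unif _ H_bd] H_m1)+
      have "(\<integral>t. \<Phi> s t \<partial>unif) \<le> (\<integral>t. H s t + H t s \<partial>unif)"
      proof (rule integral_mono_AE)
        show "integrable unif (\<Phi> s)"
          using measurable_compose[OF measurable_Pair1' \<Phi>_m, of s] \<Phi>_bd
          by (intro prob_integrable_bounded[OF prob_space_unif, of _ 1])
              (auto simp: abs_le_iff intro: order_trans[of "- _" 0])
        show "AE t in unif. \<Phi> s t \<le> H s t + H t s"
          using AE_unif by eventually_elim (use elim \<Phi>_le in auto)
      qed (use h in auto)
      also have "\<dots> = (\<integral>t. H s t \<partial>unif) + (\<integral>t. H t s \<partial>unif)"
        using h by (rule Bochner_Integration.integral_add)
      finally show ?case .
    qed
  qed
  also have "\<dots> = (\<integral>s. \<integral>t. H s t \<partial>unif \<partial>unif) + (\<integral>s. \<integral>t. H t s \<partial>unif \<partial>unif)"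
    by (intro Bochner_Integration.integral_add int[OF _ H_bd] H_m)
  also have "(\<integral>s. \<integral>t. H t s \<partial>unif \<partial>unif) = (\<integral>s. \<integral>t. H s t \<partial>unif \<partial>unif)"
    using H_m by (intro prob_Fubini_bounded[OF prob_space_unif prob_space_unif _ H_bd])
        (simp add: case_prod_beta')
  also have "(\<integral>s. \<integral>t. H s t \<partial>unif \<partial>unif)
      = (\<integral>s. of_bool (k \<le> d) * Bernstein (Suc d) k s / (real d + 1) \<partial>unif)"
  proof (intro integral_cong_AE)
    show "(\<lambda>s. \<integral>t. H s t \<partial>unif) \<in> borel_measurable unif"
      using H_m by (intro borel_measurable_prob_integral[OF prob_space_unif])
          (simp add: case_prod_beta')
    show "AE s in unif. (\<integral>t. H s t \<partial>unif) = of_bool (k \<le> d) * Bernstein (Suc d) k s / (real d + 1)"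
      using AE_unif by eventually_elim (simp add: H_int)
  qed simp
  also have "\<dots> = of_bool (k \<le> d) / ((real d + 1) * (real d + 2))"
    using integral_Bernstein[of k "Suc d"] by (simp add: add_ac mult_ac)
  also have "\<dots> + \<dots> \<le> 2 / ((real d + 1) * (real d + 2))" by (simp flip: add_divide_distrib)
  finally show ?thesis by (simp add: d_def)
qed

section \<open>The variance of the conditional expectations\<close>

text \<open>By \<open>YZ\<close> and \<open>ZZ\<close> the centred \<open>Z i\<close> are
  orthogonal, of squared norm \<open>q - \<mu>\<^sup>2\<close>, and each is the projection of the
  centred \<open>Y\<close> on its own direction. The claim is that the residual of \<open>Y\<close>
  after subtracting all of them has nonnegative second moment.\<close>

lemma Bessel_variance:
  fixes Y :: "'b \<Rightarrow> real" and Z :: "'i \<Rightarrow> 'b \<Rightarrow> real"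
  assumes "prob_space M" and J: "finite J"
    and bounded: "\<And>x. \<bar>Y x\<bar> \<le> 1" "\<And>i x. i \<in> J \<Longrightarrow> \<bar>Z i x\<bar> \<le> 1"
    and meas: "Y \<in> borel_measurable M" "\<And>i. i \<in> J \<Longrightarrow> Z i \<in> borel_measurable M"
    and mean: "(\<integral>x. Y x \<partial>M) = \<mu>" "\<And>i. i \<in> J \<Longrightarrow> (\<integral>x. Z i x \<partial>M) = \<mu>"
    and YZ: "\<And>i. i \<in> J \<Longrightarrow> (\<integral>x. Y x * Z i x \<partial>M) = q"
    and ZZ: "\<And>i. i \<in> J \<Longrightarrow> (\<integral>x. Z i x * Z i x \<partial>M) = q"
      "\<And>i j. i \<in> J \<Longrightarrow> j \<in> J \<Longrightarrow> i \<noteq> j \<Longrightarrow> (\<integral>x. Z i x * Z j x \<partial>M) = \<mu>\<^sup>2"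
  shows "real (card J) * (q - \<mu>\<^sup>2) \<le> (\<integral>x. (Y x)\<^sup>2 \<partial>M) - \<mu>\<^sup>2"
proof -
  interpret prob_space M by fact
  have int_prod: "integrable M (\<lambda>x. f x * g x)"
    if "f \<in> borel_measurable M" "g \<in> borel_measurable M" "\<And>x. \<bar>f x\<bar> \<le> 1" "\<And>x. \<bar>g x\<bar> \<le> 1"
    for f g :: "'b \<Rightarrow> real"
    using that assms(1) by (intro prob_integrable_bounded[of _ _ 1])
        (auto simp: abs_mult intro!: mult_le_one)
  have int: "integrable M f" if "f \<in> borel_measurable M" "\<And>x. \<bar>f x\<bar> \<le> 1" for f :: "'b \<Rightarrow> real"
    using that assms(1) by (intro prob_integrable_bounded[of _ _ 1]) auto
  have centred_int: "integrable M (\<lambda>x. (f x - \<mu>) * (g x - \<mu>))"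
    and centred: "(\<integral>x. (f x - \<mu>) * (g x - \<mu>) \<partial>M) = (\<integral>x. f x * g x \<partial>M) - \<mu>\<^sup>2"
    if "f \<in> borel_measurable M" "g \<in> borel_measurable M" "\<And>x. \<bar>f x\<bar> \<le> 1" "\<And>x. \<bar>g x\<bar> \<le> 1"
      "(\<integral>x. f x \<partial>M) = \<mu>" "(\<integral>x. g x \<partial>M) = \<mu>" for f g :: "'b \<Rightarrow> real"
  proof -
    have *: "(f x - \<mu>) * (g x - \<mu>) = f x * g x - \<mu> * f x - \<mu> * g x + \<mu>\<^sup>2" for x
      by (simp add: algebra_simps power2_eq_square)
    note i = int_prod[OF that(1-4)] int[OF that(1,3)] int[OF that(2,4)]
    show "integrable M (\<lambda>x. (f x - \<mu>) * (g x - \<mu>))"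
      unfolding * using i by simp
    show "(\<integral>x. (f x - \<mu>) * (g x - \<mu>) \<partial>M) = (\<integral>x. f x * g x \<partial>M) - \<mu>\<^sup>2"
      unfolding * using i that(5,6) by (simp add: prob_space power2_eq_square)
  qed
  have "0 \<le> (\<integral>x. ((Y x - \<mu>) - (\<Sum>i\<in>J. Z i x - \<mu>))\<^sup>2 \<partial>M)" by simp
  also have "\<dots> = (\<integral>x. (Y x - \<mu>) * (Y x - \<mu>) - 2 * (\<Sum>i\<in>J. (Y x - \<mu>) * (Z i x - \<mu>))
      + (\<Sum>i\<in>J. \<Sum>j\<in>J. (Z i x - \<mu>) * (Z j x - \<mu>)) \<partial>M)"
  proof -
    have *: "(a - S)\<^sup>2 = a * a - 2 * (a * S) + S * S" for a S :: real
      by (simp add: power2_eq_square algebra_simps)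
    show ?thesis unfolding * sum_product by (simp only: sum_distrib_left)
  qed
  also have "\<dots> = (\<integral>x. (Y x - \<mu>) * (Y x - \<mu>) \<partial>M) - 2 * (\<Sum>i\<in>J. \<integral>x. (Y x - \<mu>) * (Z i x - \<mu>) \<partial>M)
      + (\<Sum>i\<in>J. \<Sum>j\<in>J. \<integral>x. (Z i x - \<mu>) * (Z j x - \<mu>) \<partial>M)"
  proof -
    have i: "integrable M (\<lambda>x. (Y x - \<mu>) * (Y x - \<mu>))"
      "\<And>i. i \<in> J \<Longrightarrow> integrable M (\<lambda>x. (Y x - \<mu>) * (Z i x - \<mu>))"
      "\<And>i j. i \<in> J \<Longrightarrow> j \<in> J \<Longrightarrow> integrable M (\<lambda>x. (Z i x - \<mu>) * (Z j x - \<mu>))"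
      by (intro centred_int bounded meas mean; assumption)+
    show ?thesis using i
      by (simp add: Bochner_Integration.integrable_sum Bochner_Integration.integral_sum)
  qed
  also have "\<dots> = ((\<integral>x. (Y x)\<^sup>2 \<partial>M) - \<mu>\<^sup>2) - 2 * (\<Sum>i\<in>J. q - \<mu>\<^sup>2)
      + (\<Sum>i\<in>J. \<Sum>j\<in>J. if i = j then q - \<mu>\<^sup>2 else 0)"
  proof -
    have "(\<integral>x. (Y x - \<mu>) * (Y x - \<mu>) \<partial>M) = (\<integral>x. (Y x)\<^sup>2 \<partial>M) - \<mu>\<^sup>2"
      by (subst centred) (auto simp: bounded meas mean power2_eq_square)
    moreover have "(\<integral>x. (Y x - \<mu>) * (Z i x - \<mu>) \<partial>M) = q - \<mu>\<^sup>2" if "i \<in> J" for i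
      using that by (subst centred) (auto simp: bounded meas mean YZ)
    moreover have "(\<integral>x. (Z i x - \<mu>) * (Z j x - \<mu>) \<partial>M) = (if i = j then q - \<mu>\<^sup>2 else 0)"
        if "i \<in> J" "j \<in> J" for i j
      using that by (subst centred) (auto simp: bounded meas mean ZZ)
    ultimately show ?thesis by simp
  qed
  also have "\<dots> = ((\<integral>x. (Y x)\<^sup>2 \<partial>M) - \<mu>\<^sup>2) - real (card J) * (q - \<mu>\<^sup>2)"
    using J by simp
  finally show ?thesis by simp
qed

text \<open>Functions of disjoint blocks of weights are independent. Splitting off only
  \<open>B\<close> suffices, as \<open>A\<close> lies in the remaining index set.\<close>

lemma integral_mult_indep:
  fixes F G :: "('a \<Rightarrow> real) \<Rightarrow> real"
  assumes I: "finite I" "A \<subseteq> I" "B \<subseteq> I" "A \<inter> B = {}"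
    and F: "F \<in> borel_measurable (weights I)" "\<And>x. \<bar>F x\<bar> \<le> 1"
    and G: "G \<in> borel_measurable (weights I)" "\<And>x. \<bar>G x\<bar> \<le> 1"
    and depF: "\<And>x y. (\<And>w. w \<in> A \<Longrightarrow> x w = y w) \<Longrightarrow> F x = F y"
    and depG: "\<And>x y. (\<And>w. w \<in> B \<Longrightarrow> x w = y w) \<Longrightarrow> G x = G y"
  shows "(\<integral>x. F x * G x \<partial>weights I) = (\<integral>x. F x \<partial>weights I) * (\<integral>x. G x \<partial>weights I)"
proof -
  have fin: "finite B" using I finite_subset by metis
  note fold = integral_weights_merge[OF I(1,3)]
  have FG: "F (merge (I - B) B (x, y)) = F x" "G (merge (I - B) B (x, y)) = G y" for x y
    using I by (auto intro!: depF depG simp: merge_def)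
  interpret PB: prob_space "weights B" by (rule prob_space_weights)
  interpret PA: prob_space "weights (I - B)" by (rule prob_space_weights)
  have "(\<integral>x. F x * G x \<partial>weights I) = (\<integral>x. F x \<partial>weights (I - B)) * (\<integral>x. G x \<partial>weights B)"
    using F G by (intro trans[OF fold]) (auto simp: FG abs_mult intro!: mult_le_one)
  moreover have "(\<integral>x. F x \<partial>weights I) = (\<integral>x. F x \<partial>weights (I - B))"
    using F by (intro trans[OF fold]) (auto simp: FG PB.prob_space)
  moreover have "(\<integral>x. G x \<partial>weights I) = (\<integral>x. G x \<partial>weights B)"
    using G by (intro trans[OF fold]) (auto simp: FG PA.prob_space)
  ultimately show ?thesis by simp
qed

lemma abs_gap_le_1: "\<bar>gap k S x\<bar> \<le> 1"
  using gap_bounds[of k S x] by simp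

lemma abs_cgap_le_1: "\<bar>cgap k m S x\<bar> \<le> 1"
  using cgap_bounds[of k m S x] by simp

text \<open>Given the weights in \<open>C\<close>, the two gaps are independent with the same
  conditional expectation, as \<open>A\<close> and \<open>B\<close> have equal size. The proof
  averages over \<open>B\<close> and then over \<open>A\<close>.\<close>

lemma integral_mult_gap_Un:
  assumes I: "finite I" "A \<subseteq> I" "B \<subseteq> I" "C \<subseteq> I" "C \<inter> A = {}" "C \<inter> B = {}" "A \<inter> B = {}"
    and "card A = m" "card B = m"
  shows "(\<integral>x. gap k (C \<union> A) x * gap k (C \<union> B) x \<partial>weights I) = (\<integral>x. (cgap k m C x)\<^sup>2 \<partial>weights I)"
proof -
  have fin: "finite A" "finite B" "finite C" using I finite_subset by metis+
  have "(\<integral>x. gap k (C \<union> A) x * gap k (C \<union> B) x \<partial>weights I)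
      = (\<integral>x. gap k (C \<union> A) x * cgap k (card B) C x \<partial>weights I)"
  proof (rule integral_mult_gap)
    show "gap k (C \<union> A) x = gap k (C \<union> A) y" if "\<And>w. w \<in> I - B \<Longrightarrow> x w = y w" for x y
      by (rule gap_cong, rule that) (use I in auto)
  qed (use I fin in \<open>auto intro!: abs_gap_le_1 gap_measurable\<close>)
  also have "\<dots> = (\<integral>x. cgap k m C x * gap k (C \<union> A) x \<partial>weights I)"
    using assms by (simp add: mult.commute)
  also have "\<dots> = (\<integral>x. cgap k m C x * cgap k (card A) C x \<partial>weights I)"
  proof (rule integral_mult_gap)
    show "cgap k m C x = cgap k m C y" if "\<And>w. w \<in> I - A \<Longrightarrow> x w = y w" for x y
      by (rule cgap_cong, rule that) (use I in auto)
  qed (use I fin in \<open>auto intro!: abs_cgap_le_1 cgap_measurable\<close>)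
  also have "\<dots> = (\<integral>x. (cgap k m C x)\<^sup>2 \<partial>weights I)"
    using assms by (simp add: power2_eq_square)
  finally show ?thesis .
qed

text \<open>Bessel's inequality for disjoint blocks of size \<open>card C\<close> among
  \<open>d\<close> points. The constant 4 is the 2 of the second moment of a gap times the 2 lost in
  rounding \<open>d / c\<close> down.\<close>

lemma variance_cgap_le:
  assumes "finite I" "C \<subseteq> I" "k \<le> card C + m" "d = card C + m"
  shows "(\<integral>x. (cgap k m C x)\<^sup>2 \<partial>weights I) - (1 / (real d + 1))\<^sup>2
    \<le> 4 * real (card C) / (real d * (real d + 1) * (real d + 2))"
proof (cases "C = {}")
  \<comment> \<open>Without points in \<open>C\<close>, \<open>cgap\<close> is constant and equals
    its mean, so the variance is 0. Blocks of size 0 would give no information.\<close>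
  case True
  interpret PI: prob_space "weights I" by (rule prob_space_weights)
  have c: "cgap k m C x = cgap k m C (\<lambda>_. 0)" for x
    by (rule cgap_cong) (simp add: True)
  have "cgap k m C (\<lambda>_. 0) = (\<integral>x. cgap k m C x \<partial>weights I)"
    by (subst c) (simp add: PI.prob_space)
  also have "\<dots> = 1 / (real d + 1)"
    using integral_cgap[OF assms(1-3)] assms(4) by simp
  finally have "(\<integral>x. (cgap k m C x)\<^sup>2 \<partial>weights I) = (1 / (real d + 1))\<^sup>2"
    by (subst c) (simp add: PI.prob_space)
  then show ?thesis using True by simp
next
  case False
  define c where "c = card C"
  have fin: "finite C" using assms finite_subset by metis
  with False have c: "0 < c" "c \<le> d" using assms by (auto simp: c_def card_gt_0_iff)
  define q where "q = (\<integral>x. (cgap k m C x)\<^sup>2 \<partial>weights I)"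
  define \<mu> where "\<mu> = 1 / (real d + 1)"
  define W where "W = weights {..<d}"
  define J where "J = {..<d div c}"
  \<comment> \<open>Consecutive intervals of length \<open>c\<close>; the first
    \<open>d div c\<close> of them fit into \<open>{..<d}\<close>. Each takes the role of
    \<open>C\<close>, with the same moments.\<close>
  define D where "D = (\<lambda>i. {i * c..<i * c + c})"
  have D: "D i \<subseteq> {..<d}" "card (D i) = c" if "i \<in> J" for i
  proof -
    have "Suc i * c \<le> d div c * c" using that by (intro mult_right_mono) (auto simp: J_def)
    also have "\<dots> \<le> d" by simp
    finally show "D i \<subseteq> {..<d}" "card (D i) = c" by (auto simp: D_def)
  qed
  have Dfin: "finite (D i)" for i by (simp add: D_def)
  have disj: "D i \<inter> D j = {}" if "i \<noteq> j" for i j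
  proof -
    have "D i \<inter> D j = {}" if "i < j" for i j
    proof -
      have "Suc i * c \<le> j * c" using that by (intro mult_right_mono) auto
      then show ?thesis by (auto simp: D_def)
    qed
    with that show ?thesis by (metis Int_commute nat_neq_iff)
  qed
  have q: "(\<integral>x. cgap k m (D i) x * cgap k m (D i) x \<partial>W) = q" if "i \<in> J" for i
    unfolding q_def W_def power2_eq_square[symmetric]
    by (rule integral_cgap_eq[where F = "\<lambda>x. x\<^sup>2"])
        (use D[OF that] fin assms in \<open>simp_all add: c_def D_def\<close>)
  have mean: "(\<integral>x. cgap k m (D i) x \<partial>W) = \<mu>" if "i \<in> J" for i
    unfolding W_def \<mu>_def using integral_cgap[of "{..<d}" "D i" k m] D[OF that] assms
    by (simp add: c_def)
  have "real (card J) * (q - \<mu>\<^sup>2) \<le> (\<integral>x. (gap k {..<d} x)\<^sup>2 \<partial>W) - \<mu>\<^sup>2"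
  proof (rule Bessel_variance)
    show "prob_space W" unfolding W_def by (rule prob_space_weights)
    show "finite J" by (simp add: J_def)
    show "gap k {..<d} \<in> borel_measurable W" unfolding W_def by (rule gap_measurable) auto
    show "cgap k m (D i) \<in> borel_measurable W" if "i \<in> J" for i
      unfolding W_def by (rule cgap_measurable) (use D[OF that] Dfin in auto)
    show "(\<integral>x. gap k {..<d} x \<partial>W) = \<mu>"
      unfolding W_def \<mu>_def using integral_gap[of "{..<d}" "{..<d}" k] assms by simp
    show "(\<integral>x. gap k {..<d} x * cgap k m (D i) x \<partial>W) = q" if "i \<in> J" for i
    proof -
      \<comment> \<open>Exactly \<open>m\<close> of the \<open>d\<close> points lie outside the
        block, so the conditional expectation of the full gap given the block is
        \<open>cgap k m (D i)\<close>.\<close>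
      have "(\<integral>x. cgap k m (D i) x * gap k (D i \<union> ({..<d} - D i)) x \<partial>W)
        = (\<integral>x. cgap k m (D i) x * cgap k (card ({..<d} - D i)) (D i) x \<partial>W)"
        unfolding W_def using D[OF that] Dfin
        by (intro integral_mult_gap abs_cgap_le_1 cgap_measurable cgap_cong) auto
      moreover have "D i \<union> ({..<d} - D i) = {..<d}" using D[OF that] by auto
      moreover have "card ({..<d} - D i) = m"
        using D[OF that] Dfin assms by (subst card_Diff_subset) (auto simp: c_def)
      ultimately show ?thesis using q[OF that] by (simp add: mult.commute)
    qed
    show "(\<integral>x. cgap k m (D i) x * cgap k m (D j) x \<partial>W) = \<mu>\<^sup>2" if "i \<in> J" "j \<in> J" "i \<noteq> j" for i j
    proof -
      have "(\<integral>x. cgap k m (D i) x * cgap k m (D j) x \<partial>W)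
        = (\<integral>x. cgap k m (D i) x \<partial>W) * (\<integral>x. cgap k m (D j) x \<partial>W)"
        unfolding W_def
        by (rule integral_mult_indep[of _ "D i" "D j"])
           (use D[OF that(1)] D[OF that(2)] Dfin disj[OF that(3)] in
             \<open>auto intro!: abs_cgap_le_1 cgap_measurable cgap_cong\<close>)
      then show ?thesis using mean that by (simp add: power2_eq_square)
    qed
  qed (use mean q abs_gap_le_1 abs_cgap_le_1 in auto)
  also have "\<dots> \<le> (\<integral>x. (gap k {..<d} x)\<^sup>2 \<partial>W)" by simp
  also have "\<dots> \<le> 2 / ((real d + 1) * (real d + 2))"
    unfolding W_def using integral_gap_sq_le[of "{..<d}" "{..<d}" k] by simp
  finally have V: "real (d div c) * (q - \<mu>\<^sup>2) \<le> 2 / ((real d + 1) * (real d + 2))"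
    by (simp add: J_def)
  \<comment> \<open>As \<open>d div c\<close> is at least 1, the remainder, which is less than
    \<open>c\<close>, is also less than \<open>c * (d div c)\<close>.\<close>
  have "d \<le> 2 * c * (d div c)"
  proof -
    have "1 \<le> d div c" using c by (simp add: div_greater_zero_iff Suc_leI)
    then have "c \<le> c * (d div c)" by simp
    moreover have "d < c * (d div c) + c" using c
      by (metis mult.commute dividend_less_div_times add.commute)
    ultimately show ?thesis by linarith
  qed
  then have dc: "real d \<le> 2 * real c * real (d div c)"
    by (metis of_nat_le_iff of_nat_mult of_nat_numeral)
  have "real d * (q - \<mu>\<^sup>2) \<le> 2 * real c * (2 / ((real d + 1) * (real d + 2)))"
  \<comment> \<open>The estimate \<open>dc\<close> can be multiplied by
    \<open>q - \<mu>\<^sup>2\<close> if this is positive; otherwise the left side is at most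
    0.\<close>
  proof (cases "q - \<mu>\<^sup>2 \<le> 0")
    case True
    then have "real d * (q - \<mu>\<^sup>2) \<le> 0" by (simp add: mult_nonneg_nonpos)
    then show ?thesis by (rule order_trans) simp
  next
    case False
    then have "real d * (q - \<mu>\<^sup>2) \<le> 2 * real c * real (d div c) * (q - \<mu>\<^sup>2)"
      using dc by (intro mult_right_mono) auto
    also have "\<dots> \<le> 2 * real c * (2 / ((real d + 1) * (real d + 2)))"
      using V by (simp only: mult.assoc) (intro mult_left_mono, auto)
    finally show ?thesis .
  qed
  then have "(q - \<mu>\<^sup>2) * real d \<le> 4 * real c / ((real d + 1) * (real d + 2))"
    by (simp add: mult.commute)
  then have "q - \<mu>\<^sup>2 \<le> 4 * real c / ((real d + 1) * (real d + 2)) / real d"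
    using c by (subst pos_le_divide_eq) auto
  then show ?thesis by (simp add: q_def \<mu>_def c_def mult_ac)
qed

section \<open>Regular neighbourhood systems\<close>

lemma upcount_component_measurable:
  assumes "finite S" "S \<subseteq> I" "v \<in> I"
  shows "(\<lambda>x. of_bool (upcount S (x v) x = k) :: real) \<in> borel_measurable (weights I)"
proof -
  have "(\<lambda>x. x v) \<in> borel_measurable (weights I)"
    using measurable_component_singleton[OF assms(3), of "\<lambda>_. unif"]
    by (simp cong: measurable_cong_sets)
  note [measurable] = upcount_measurable[OF assms(1,2) this measurable_ident_sets[OF refl]]
  show ?thesis by measurable
qed

text \<open>The weight of \<open>v\<close> affects neither \<open>H\<close> nor the points of
  \<open>S\<close>. Integrating it first turns the indicator into the length of the set of
  admissible levels, which is the gap.\<close>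

lemma integral_mult_upcount_component:
  assumes I: "finite I" "S \<subseteq> I" "v \<in> I" "v \<notin> S"
    and H: "H \<in> borel_measurable (weights I)" "\<And>x. \<bar>H x\<bar> \<le> 1" "\<And>x y. H (x(v := y)) = H x"
  shows "(\<integral>x. H x * of_bool (upcount S (x v) x = k) \<partial>weights I) = (\<integral>x. H x * gap k S x \<partial>weights I)"
proof -
  define I' where "I' = I - {v}"
  have I': "I = insert v I'" "finite I'" "v \<notin> I'" "S \<subseteq> I'" "finite S" "finite I"
    using I finite_subset by (auto simp: I'_def)
  have fold: "(\<integral>x. f x \<partial>weights I) = (\<integral>x. \<integral>y. f (x(v := y)) \<partial>unif \<partial>weights I')"
    if "f \<in> borel_measurable (weights I)" "\<And>x. \<bar>f x\<bar> \<le> 1" for f :: "_ \<Rightarrow> real"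
    unfolding I'(1)
    by (intro weights.product_integral_insert I' prob_integrable_bounded[of _ _ 1]
        prob_space_weights)
       (use that I'(1) in auto)
  have u: "upcount S t (x(v := y)) = upcount S t x" for t x y
    using I by (intro upcount_cong) auto
  have "(\<integral>x. H x * of_bool (upcount S (x v) x = k) \<partial>weights I) = (\<integral>x. H x * gap k S x \<partial>weights I')"
    using I I' H upcount_component_measurable[of S I v k]
    by (intro trans[OF fold]) (auto simp: u gap_def abs_mult fun_upd_same intro!: mult_le_one
        simp del: fun_upd_apply)
  moreover have "(\<integral>x. H x * gap k S x \<partial>weights I) = (\<integral>x. H x * gap k S x \<partial>weights I')"
    using I I' H gap_measurable[of S I k]
    by (intro trans[OF fold]) (auto simp: u gap_def[of k S "_(_:=_)"] unif.prob_space abs_mult gap_bounds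
        intro!: mult_le_one simp del: fun_upd_apply simp flip: gap_def)
  ultimately show ?thesis by simp
qed

text \<open>With \<open>N v\<close> the neighbourhood of \<open>v\<close>, this is the indicator
  that \<open>v\<close> has degree \<open>k\<close> in the random subgraph.\<close>

definition deg_eq :: "('a \<Rightarrow> 'a set) \<Rightarrow> nat \<Rightarrow> 'a \<Rightarrow> ('a \<Rightarrow> real) \<Rightarrow> real" where
  "deg_eq N k v x = of_bool (upcount (N v) (x v) x = k)"

section \<open>Covariances of the degree indicators\<close>

context
  fixes V :: "'a set" and N :: "'a \<Rightarrow> 'a set" and d k :: nat
  assumes V: "finite V" and N: "\<And>v. v \<in> V \<Longrightarrow> N v \<subseteq> V" "\<And>v. v \<notin> N v" "\<And>u v. u \<in> N v \<longleftrightarrow> v \<in> N u"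
    and card_N: "\<And>v. v \<in> V \<Longrightarrow> card (N v) = d" and k: "k \<le> d"
begin

lemma N_finite: "v \<in> V \<Longrightarrow> finite (N v)"
  using N(1) V finite_subset by metis

lemma deg_eq_measurable: "v \<in> V \<Longrightarrow> deg_eq N k v \<in> borel_measurable (weights V)"
  unfolding deg_eq_def using N N_finite by (intro upcount_component_measurable) auto

lemma deg_eq_mult_integrable:
  assumes "u \<in> V" "v \<in> V"
  shows "integrable (weights V) (\<lambda>x. deg_eq N k u x * deg_eq N k v x)"
proof (rule prob_integrable_bounded[OF prob_space_weights])
  show "(\<lambda>x. deg_eq N k u x * deg_eq N k v x) \<in> borel_measurable (weights V)"
    using assms by (intro borel_measurable_times deg_eq_measurable)
  show "\<bar>deg_eq N k u x * deg_eq N k v x\<bar> \<le> 1" for x by (simp add: deg_eq_def)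
qed

lemma gap_fun_upd: "v \<notin> S \<Longrightarrow> gap k' S (x(v := y)) = gap k' S x"
  by (intro gap_cong) auto

lemma integral_deg_eq:
  assumes "v \<in> V"
  shows "(\<integral>x. deg_eq N k v x \<partial>weights V) = 1 / (real d + 1)"
proof -
  have "(\<integral>x. 1 * deg_eq N k v x \<partial>weights V) = (\<integral>x. 1 * gap k (N v) x \<partial>weights V)"
    unfolding deg_eq_def using assms N V by (intro integral_mult_upcount_component) auto
  also have "\<dots> = 1 / (real d + 1)"
    using integral_gap[of V "N v" k] assms V N card_N k by simp
  finally show ?thesis by simp
qed

text \<open>Neither \<open>x u\<close> nor \<open>x v\<close> is among the points of
  \<open>S\<close> and \<open>T\<close>, so the two weights can be integrated out one after the
  other, each turning one indicator into a gap.\<close>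

lemma integral_upcount_component_pair:
  assumes "u \<in> V" "v \<in> V" "u \<noteq> v" "S \<subseteq> V" "T \<subseteq> V" "u \<notin> S \<union> T" "v \<notin> S \<union> T"
  shows "(\<integral>x. of_bool (upcount S (x u) x = k') * of_bool (upcount T (x v) x = k') \<partial>weights V)
    = (\<integral>x. gap k' S x * gap k' T x \<partial>weights V)"
proof -
  have fin: "finite S" "finite T" using assms V finite_subset by metis+
  have "(\<integral>x. of_bool (upcount S (x u) x = k') * of_bool (upcount T (x v) x = k') \<partial>weights V)
    = (\<integral>x. of_bool (upcount S (x u) x = k') * gap k' T x \<partial>weights V)"
  proof (intro integral_mult_upcount_component upcount_component_measurable)
    have "upcount S s (x(v := y)) = upcount S s x" for s x y
      by (rule upcount_cong) (use assms in auto)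
    then show "of_bool (upcount S ((x(v := y)) u) (x(v := y)) = k')
      = (of_bool (upcount S (x u) x = k') :: real)" for x y
      using assms(3) by simp
  qed (use assms V fin in auto)
  also have "\<dots> = (\<integral>x. gap k' T x * of_bool (upcount S (x u) x = k') \<partial>weights V)"
    by (simp only: mult.commute)
  also have "\<dots> = (\<integral>x. gap k' T x * gap k' S x \<partial>weights V)"
    by (intro integral_mult_upcount_component gap_measurable abs_gap_le_1 gap_fun_upd)
        (use assms V fin in auto)
  finally show ?thesis by (simp only: mult.commute)
qed

text \<open>Once the edge \<open>uv\<close> is set aside, the gaps are those of \<open>d - 1\<close>
  points. AM-GM bounds their mixed moment by \<open>2 / (d (d + 1))\<close>, and the two possible
  residual degrees double this.\<close>

lemma integral_deg_eq_adjacent: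
  assumes "u \<in> V" "v \<in> V" "u \<in> N v"
  shows "(\<integral>x. deg_eq N k u x * deg_eq N k v x \<partial>weights V) \<le> 4 / (real d * (real d + 1))"
proof -
  define S where "S = N u - {v}"
  define T where "T = N v - {u}"
  have vu: "v \<in> N u" "u \<noteq> v" using assms N by auto
  have fin: "finite S" "finite T" using assms N_finite by (auto simp: S_def T_def)
  have sub: "S \<subseteq> V" "T \<subseteq> V" "u \<notin> S \<union> T" "v \<notin> S \<union> T"
    using assms N by (auto simp: S_def T_def)
  have d: "0 < d" using card_N[OF assms(2)] assms(3) N_finite[OF assms(2)]
    by (metis card_gt_0_iff empty_iff)
  have card: "card S = d - 1" "card T = d - 1"
    using assms vu card_N N_finite by (simp_all add: S_def T_def)
  \<comment> \<open>Apart from the edge \<open>uv\<close> itself, both vertices need \<open>k\<close> or both need \<open>k - 1\<close> further neighbours.\<close>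
  define p :: "nat \<Rightarrow> ('a \<Rightarrow> real) \<Rightarrow> real"
    where "p = (\<lambda>k' x. of_bool (upcount S (x u) x = k') * of_bool (upcount T (x v) x = k'))"
  have p_m: "p k' \<in> borel_measurable (weights V)" for k'
    unfolding p_def using assms sub fin
    by (intro borel_measurable_times upcount_component_measurable) auto
  have p_int: "integrable (weights V) (p k')" for k'
    by (intro prob_integrable_bounded[OF prob_space_weights p_m, of _ 1]) (simp add: p_def)
  have p_le: "(\<integral>x. p k' x \<partial>weights V) \<le> 2 / (real d * (real d + 1))" for k'
  proof -
    have g: "gap k' S \<in> borel_measurable (weights V)" "gap k' T \<in> borel_measurable (weights V)"
      using fin sub by (auto intro!: gap_measurable)
    have sq: "integrable (weights V) (\<lambda>x. (gap k' S x)\<^sup>2)"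
        "integrable (weights V) (\<lambda>x. (gap k' T x)\<^sup>2)"
      using g by (auto intro!: prob_integrable_bounded[OF prob_space_weights, of _ _ 1]
          simp: abs_square_le_1 abs_gap_le_1)
    have pr: "integrable (weights V) (\<lambda>x. gap k' S x * gap k' T x)"
      using g by (intro prob_integrable_bounded[OF prob_space_weights, of _ _ 1])
          (auto simp: abs_mult gap_bounds intro!: mult_le_one)
    have "(\<integral>x. p k' x \<partial>weights V) = (\<integral>x. gap k' S x * gap k' T x \<partial>weights V)"
      unfolding p_def by (rule integral_upcount_component_pair) (use assms vu sub in auto)
    also have "\<dots> \<le> (\<integral>x. ((gap k' S x)\<^sup>2 + (gap k' T x)\<^sup>2) / 2 \<partial>weights V)"
    proof (intro integral_mono pr)
      show "gap k' S x * gap k' T x \<le> ((gap k' S x)\<^sup>2 + (gap k' T x)\<^sup>2) / 2" for x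
        using sum_squares_bound[of "gap k' S x" "gap k' T x"] by simp
    qed (use sq in auto)
    also have "\<dots> = ((\<integral>x. (gap k' S x)\<^sup>2 \<partial>weights V) + (\<integral>x. (gap k' T x)\<^sup>2 \<partial>weights V)) / 2"
      using sq by simp
    also have "\<dots> \<le> 2 / (real d * (real d + 1))"
    proof -
      have "real (d - 1) + 1 = real d" "real (d - 1) + 2 = real d + 1" using d by auto
      then have "(\<integral>x. (gap k' S x)\<^sup>2 \<partial>weights V) \<le> 2 / (real d * (real d + 1))"
        "(\<integral>x. (gap k' T x)\<^sup>2 \<partial>weights V) \<le> 2 / (real d * (real d + 1))"
        using integral_gap_sq_le[OF V sub(1), of k'] integral_gap_sq_le[OF V sub(2), of k'] card
            by (simp_all add: add.commute)
      moreover have "(a + b) / 2 \<le> c" if "a \<le> c" "b \<le> c" for a b c :: real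
        using that by simp
      ultimately show ?thesis by blast
    qed
    finally show ?thesis .
  qed
  have "(\<integral>x. deg_eq N k u x * deg_eq N k v x \<partial>weights V) \<le> (\<integral>x. p k x + p (k - 1) x \<partial>weights V)"
  proof (rule integral_mono)
    show "integrable (weights V) (\<lambda>x. deg_eq N k u x * deg_eq N k v x)"
      using assms by (intro deg_eq_mult_integrable)
    \<comment> \<open>If the edge \<open>uv\<close> is present both residual counts are
      \<open>k - 1\<close>, otherwise both are \<open>k\<close>. For \<open>k = 0\<close> the edge
      must be absent, and the truncated \<open>k - 1\<close> only repeats a nonnegative
      term.\<close>
    show "deg_eq N k u x * deg_eq N k v x \<le> p k x + p (k - 1) x" for x
    proof -
      have "N u = insert v S" "N v = insert u T" using assms vu by (auto simp: S_def T_def)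
      moreover have "v \<notin> S" "u \<notin> T" by (auto simp: S_def T_def)
      ultimately show ?thesis
        using fin by (auto simp: deg_eq_def p_def upcount_insert add.commute)
    qed
  qed (use p_int in auto)
  also have "\<dots> = (\<integral>x. p k x \<partial>weights V) + (\<integral>x. p (k - 1) x \<partial>weights V)"
    using p_int by simp
  also have "\<dots> \<le> 4 / (real d * (real d + 1))"
    using p_le[of k] p_le[of "k - 1"] by simp
  finally show ?thesis .
qed

text \<open>The weights of \<open>u\<close> and \<open>v\<close> lie in neither neighbourhood, so
  both indicators become gaps. These share exactly the points in \<open>C\<close>, and the
  covariance is the variance of their common conditional expectation.\<close>

lemma covariance_deg_eq_nonadjacent:
  assumes "u \<in> V" "v \<in> V" "u \<noteq> v" "u \<notin> N v"
  shows "(\<integral>x. deg_eq N k u x * deg_eq N k v x \<partial>weights V) - (1 / (real d + 1))\<^sup>2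
    \<le> 4 * real (card (N u \<inter> N v)) / (real d * (real d + 1) * (real d + 2))"
proof -
  define C where "C = N u \<inter> N v"
  define A where "A = N u - C"
  define B where "B = N v - C"
  have uv: "v \<notin> N u" using assms N by auto
  have fin: "finite (N u)" "finite (N v)" "finite C" using assms N_finite by (auto simp: C_def)
  have eq: "N u = C \<union> A" "N v = C \<union> B" by (auto simp: A_def B_def C_def)
  have Cd: "card C \<le> d" using card_mono[of "N u" C] fin card_N assms by (auto simp: C_def)
  have cA: "card A = d - card C" "card B = d - card C"
    using fin card_N assms by (auto simp: A_def B_def C_def card_Diff_subset)
  have "(\<integral>x. deg_eq N k u x * deg_eq N k v x \<partial>weights V)
      = (\<integral>x. gap k (N u) x * gap k (N v) x \<partial>weights V)"
    unfolding deg_eq_def by (rule integral_upcount_component_pair) (use assms uv N in auto)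
  also have "\<dots> = (\<integral>x. (cgap k (d - card C) C x)\<^sup>2 \<partial>weights V)"
    unfolding eq
  proof (rule integral_mult_gap_Un)
    show "A \<subseteq> V" "B \<subseteq> V" "C \<subseteq> V" using N assms by (auto simp: A_def B_def C_def)
  qed (use V cA in \<open>auto simp: A_def B_def C_def\<close>)
  finally show ?thesis
    using variance_cgap_le[of V C k "d - card C" d] V Cd k N(1)[OF assms(1)] by (auto simp: C_def)
qed

text \<open>A single bound for all pairs, in a form that can be summed over \<open>u\<close> term by
  term. For equal or adjacent vertices the squared mean is simply dropped.\<close>

lemma covariance_deg_eq:
  assumes "u \<in> V" "v \<in> V"
  shows "(\<integral>x. deg_eq N k u x * deg_eq N k v x \<partial>weights V) - (1 / (real d + 1))\<^sup>2
    \<le> of_bool (u = v) / (real d + 1) + of_bool (u \<in> N v) * (4 / (real d * (real d + 1)))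
      + real (card (N u \<inter> N v)) * (4 / (real d * (real d + 1) * (real d + 2)))"
proof -
  have nn: "0 \<le> real (card (N u \<inter> N v)) * (4 / (real d * (real d + 1) * (real d + 2)))" by simp
  have sq: "0 \<le> (1 / (real d + 1))\<^sup>2" by simp
  consider "u = v" | "u \<noteq> v" "u \<in> N v" | "u \<noteq> v" "u \<notin> N v" by auto
  then show ?thesis
  proof cases
    case 1
    then have "(\<integral>x. deg_eq N k u x * deg_eq N k v x \<partial>weights V) = 1 / (real d + 1)"
      using integral_deg_eq[OF assms(2)] by (simp add: deg_eq_def flip: of_bool_conj)
    moreover have "of_bool (u = v) / (real d + 1) = 1 / (real d + 1)"
      "of_bool (u \<in> N v) * (4 / (real d * (real d + 1))) = 0"
      using 1 N(2)[of v] by simp_all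
    ultimately show ?thesis using nn sq by linarith
  next
    case 2
    moreover from 2 have "of_bool (u = v) / (real d + 1) = 0"
      "of_bool (u \<in> N v) * (4 / (real d * (real d + 1))) = 4 / (real d * (real d + 1))"
      by simp_all
    ultimately show ?thesis using integral_deg_eq_adjacent[OF assms 2(2)] nn sq by linarith
  next
    case 3
    then show ?thesis using covariance_deg_eq_nonadjacent[OF assms 3] by (simp add: mult.commute)
  qed
qed

text \<open>Double counting of walks \<open>u\<close>, \<open>w\<close>, \<open>v\<close> of length
  two: \<open>d\<close> choices for \<open>w\<close>, then \<open>d\<close> for \<open>u\<close>,
  with \<open>u = v\<close> included.\<close>

lemma sum_card_common:
  assumes "v \<in> V"
  shows "(\<Sum>u\<in>V. real (card (N u \<inter> N v))) = (real d)\<^sup>2"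
proof -
  have "(\<Sum>u\<in>V. card (N u \<inter> N v)) = (\<Sum>u\<in>V. \<Sum>w\<in>N v. of_bool (w \<in> N u))"
    using N_finite[OF assms] by (simp add: Int_commute Int_def)
  also have "\<dots> = (\<Sum>w\<in>N v. \<Sum>u\<in>V. of_bool (w \<in> N u))" by (rule sum.swap)
  also have "\<dots> = (\<Sum>w\<in>N v. card (N w))"
  proof (intro sum.cong refl)
    fix w assume "w \<in> N v"
    then have "w \<in> V" using N(1)[OF assms] by auto
    then have "{u \<in> V. w \<in> N u} = N w" using N(1,3) by blast
    then show "(\<Sum>u\<in>V. of_bool (w \<in> N u)) = card (N w)"
      using V by (simp add: Int_def)
  qed
  also have "\<dots> = d * d"
    using card_N N(1)[OF assms] card_N[OF assms] by (simp add: subset_iff)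
  finally show ?thesis by (metis of_nat_mult of_nat_sum power2_eq_square)
qed

text \<open>For each \<open>v\<close> the covariances add up to at most
  \<open>(1 + 4 + 4) / (d + 1)\<close>: the diagonal term, the \<open>d\<close> neighbours, and the
  total of \<open>d\<^sup>2\<close> common neighbours.\<close>

lemma variance_sum_deg_eq:
  "prob_space.variance (weights V) (\<lambda>x. \<Sum>v\<in>V. deg_eq N k v x) \<le> 9 * (real (card V) / (real d + 1))"
proof -
  interpret W: prob_space "weights V" by (rule prob_space_weights)
  define \<mu> where "\<mu> = 1 / (real d + 1)"
  have int: "integrable (weights V) (deg_eq N k v)" if "v \<in> V" for v
    by (rule prob_integrable_bounded[OF prob_space_weights deg_eq_measurable[OF that], of 1])
        (simp add: deg_eq_def)
  have int2: "integrable (weights V) (\<lambda>x. deg_eq N k u x * deg_eq N k v x)"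
      if "u \<in> V" "v \<in> V" for u v
    using that by (rule deg_eq_mult_integrable)
  have "(\<integral>x. (\<Sum>v\<in>V. deg_eq N k v x) \<partial>weights V) = (\<Sum>v\<in>V. \<mu>)"
    using int by (simp add: integral_deg_eq \<mu>_def)
  moreover have "(\<integral>x. (\<Sum>v\<in>V. deg_eq N k v x)\<^sup>2 \<partial>weights V)
      = (\<Sum>v\<in>V. \<Sum>u\<in>V. \<integral>x. deg_eq N k u x * deg_eq N k v x \<partial>weights V)"
    using int2 by (simp add: power2_eq_square sum_product mult.commute)
  ultimately have "W.variance (\<lambda>x. \<Sum>v\<in>V. deg_eq N k v x)
      = (\<Sum>v\<in>V. \<Sum>u\<in>V. \<integral>x. deg_eq N k u x * deg_eq N k v x \<partial>weights V) - (\<Sum>v\<in>V. \<mu>)\<^sup>2"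
    using int int2 by (subst W.variance_eq) (auto simp: power2_eq_square sum_product)
  also have "(\<Sum>v\<in>V. \<mu>)\<^sup>2 = (\<Sum>v\<in>V. \<Sum>u\<in>V. \<mu>\<^sup>2)" by (simp add: power2_eq_square)
  also have "(\<Sum>v\<in>V. \<Sum>u\<in>V. \<integral>x. deg_eq N k u x * deg_eq N k v x \<partial>weights V) - (\<Sum>v\<in>V. \<Sum>u\<in>V. \<mu>\<^sup>2)
    = (\<Sum>v\<in>V. \<Sum>u\<in>V. (\<integral>x. deg_eq N k u x * deg_eq N k v x \<partial>weights V) - \<mu>\<^sup>2)"
    by (simp only: sum_subtractf)
  also have "\<dots> \<le> (\<Sum>v\<in>V. 9 / (real d + 1))"
  proof (rule sum_mono)
    fix v assume v: "v \<in> V"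
    have "(\<Sum>u\<in>V. (\<integral>x. deg_eq N k u x * deg_eq N k v x \<partial>weights V) - \<mu>\<^sup>2)
      \<le> (\<Sum>u\<in>V. of_bool (u = v) / (real d + 1) + of_bool (u \<in> N v) * (4 / (real d * (real d + 1)))
      + real (card (N u \<inter> N v)) * (4 / (real d * (real d + 1) * (real d + 2))))"
      unfolding \<mu>_def by (intro sum_mono covariance_deg_eq v)
    also have "\<dots> = (\<Sum>u\<in>V. of_bool (u = v)) / (real d + 1)
      + (\<Sum>u\<in>V. of_bool (u \<in> N v)) * (4 / (real d * (real d + 1)))
      + (\<Sum>u\<in>V. real (card (N u \<inter> N v))) * (4 / (real d * (real d + 1) * (real d + 2)))"
      by (simp only: sum.distrib sum_divide_distrib sum_distrib_right)
    also have "(\<Sum>u\<in>V. of_bool (u = v)) = (1::real)"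
      using v V by (simp add: of_bool_def)
    also have "(\<Sum>u\<in>V. of_bool (u \<in> N v)) = real d"
    proof -
      have "V \<inter> {u. u \<in> N v} = N v" using N(1)[OF v] by auto
      then show ?thesis using V card_N[OF v] by simp
    qed
    also have "(\<Sum>u\<in>V. real (card (N u \<inter> N v))) = (real d)\<^sup>2" by (rule sum_card_common[OF v])
    also have "1 / (real d + 1) + real d * (4 / (real d * (real d + 1)))
        + (real d)\<^sup>2 * (4 / (real d * (real d + 1) * (real d + 2))) \<le> 9 / (real d + 1)"
    proof -
      \<comment> \<open>For \<open>d = 0\<close> the left side is 0, as division by zero gives 0;
        for \<open>d > 0\<close> equality holds.\<close>
      have "real d * (4 / (real d * (real d + 1))) \<le> 4 / (real d + 1)" by simp
      moreover have "(real d)\<^sup>2 * (4 / (real d * (real d + 1) * (real d + 2))) \<le> 4 / (real d + 1)"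
      proof -
        have "(real d)\<^sup>2 * (4 / (real d * (real d + 1) * (real d + 2)))
            = 4 / (real d + 1) * (real d / (real d + 2))"
          by (simp add: power2_eq_square)
        also have "\<dots> \<le> 4 / (real d + 1)" by (intro mult_left_le) auto
        finally show ?thesis .
      qed
      ultimately show ?thesis by (simp flip: add_divide_distrib)
    qed
    finally show "(\<Sum>u\<in>V. (\<integral>x. deg_eq N k u x * deg_eq N k v x \<partial>weights V) - \<mu>\<^sup>2)
        \<le> 9 / (real d + 1)" .
  qed
  also have "\<dots> = 9 * (real (card V) / (real d + 1))" by simp
  finally show ?thesis .
qed

end

section \<open>From regular graphs to neighbourhood systems\<close>

theorem theorem2p1:
  fixes G :: "'a pair_pre_digraph" and n d k :: nat
  assumes "pair_graph G"
    and "card (pverts G) = n"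
    and "regular G d"
    and "k \<le> d"
  shows "prob_space.variance (weight_space G)
           (\<lambda>x. real (num_degree (irregular_subgraph G x) k))
         \<le> 17 * (real n / (real d + 1))"
proof -
  interpret pair_graph G by fact
  define N where "N = (\<lambda>v. {w \<in> pverts G. (v, w) \<in> parcs G})"
  \<comment> \<open>The arcs of \<open>H\<close> leaving \<open>v\<close> correspond to the
    neighbours whose weight reaches level \<open>x v\<close>, so degrees in \<open>H\<close> are
    values of \<open>upcount\<close>.\<close>
  have degree_H: "vertex_degree (irregular_subgraph G x) v = upcount (N v) (x v) x" for x v
  proof -
    have "out_arcs (with_proj (irregular_subgraph G x)) v = Pair v ` {w \<in> N v. 1 \<le> x w + x v}"
      by (auto simp: N_def out_arcs_def irregular_subgraph_def add.commute dest: in_arcsD2)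
    then show ?thesis
      by (simp add: vertex_degree_def out_degree_def upcount_def card_image inj_on_def)
  qed
  have card_N: "card (N v) = d" if "v \<in> pverts G" for v
  proof -
    have "out_arcs (with_proj G) v = Pair v ` N v"
      by (auto simp: N_def out_arcs_def dest: in_arcsD2)
    then have "vertex_degree G v = card (N v)"
      by (simp add: vertex_degree_def out_degree_def card_image inj_on_def)
    then show ?thesis using assms(3) that by (simp add: regular_def)
  qed
  have sum_eq: "real (num_degree (irregular_subgraph G x) k) = (\<Sum>v\<in>pverts G. deg_eq N k v x)" for x
  proof -
    have "pverts (irregular_subgraph G x) = pverts G" by (simp add: irregular_subgraph_def)
    then show ?thesis
      using pair_finite_verts by (simp add: num_degree_def degree_H deg_eq_def Int_def)
  qed
  have "prob_space.variance (weight_space G) (\<lambda>x. real (num_degree (irregular_subgraph G x) k))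
    \<le> 9 * (real (card (pverts G)) / (real d + 1))"
    unfolding sum_eq weight_space_def
    using arcs_symmetric no_loops' card_N assms(4)
    by (intro variance_sum_deg_eq) (auto simp: N_def dest: in_arcsD1 in_arcsD2)
  \<comment> \<open>The constant 9 obtained above is smaller than the 17 required.\<close>
  also have "\<dots> \<le> 17 * (real n / (real d + 1))"
    unfolding assms(2) by (intro mult_right_mono) auto
  finally show ?thesis .
qed

end
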